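(* Let $\Sigma$ be a finite alphabet with at least two symbols and let $z\in\{C,B,A,\delta\}$. Then the topology $\tau_z$ on $\Sigma^{\mathbb{N}}$ is Polish and zero-dimensional.
   Context: $\Sigma^{\mathbb{N}}$ is the set of infinite words over $\Sigma$. For a finite word $w\in\Sigma^*$, $N_w=\{\sigma\in\Sigma^{\mathbb{N}}: w \text{ is a prefix of } \sigma\}$. $\tau_C$ is the Cantor (product of discrete) topology, with basis the sets $N_w$. A Büchi automaton is $\mathcal{A}=(\Sigma,Q,Q_i,Q_f,\delta)$ with finite state set $Q$, initial states $Q_i$, final states $Q_f$, transitions $\delta\subseteq Q\times\Sigma\times Q$; a run on $\sigma$ is $(q_n)_{n}\in Q^{\mathbb{N}}$ with $q_0\in Q_i$ and $(q_n,\sigma(n),q_{n+1})\in\delta$ for all $n$; it is accepting if $q_n\in Q_f$ for infinitely many $n$; $L(\mathcal{A})$ is the set of words having an accepting run. A set $L\subseteq\Sigma^{\mathbb{N}}$ is $\omega$-regular if $L=L(\mathcal{A})$ for some Büchi automaton $\mathcal{A}$. $\tau_B$ (Büchi topology) is the topology generated by the $\omega$-regular languages; $\tau_A$ (automatic topology) is the topology generated by the $\omega$-regular languages that are $\tau_C$-closed; $\tau_\delta$ is the topology generated by the effectively Borel (${\it\Delta}^1_1$, with respect to a fixed recursive presentation of $(\Sigma^{\mathbb{N}},\tau_C)$) subsets of $\Sigma^{\mathbb{N}}$, which are exactly the sets accepted by unambiguous Büchi Turing machines (those for which every input has at most one accepting run). *)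

theory Defs
  imports "HOL-Analysis.Analysis" "HOL-Library.Nat_Bijection" "HOL-Library.Countable"
begin

definition Polish_space :: "'a topology \<Rightarrow> bool" where
  "Polish_space X \<longleftrightarrow> completely_metrizable_space X \<and> separable_space X"

text \<open>Zero-dimensional: small inductive dimension 0, i.e. a base of clopen sets.\<close>
definition zero_dimensional :: "'a topology \<Rightarrow> bool" where
  "zero_dimensional X \<longleftrightarrow> X dim_le 0"

definition cantor_top :: "(nat \<Rightarrow> 'a) topology" where
  "cantor_top = product_topology (\<lambda>_. discrete_topology UNIV) UNIV"

definition buchi_lang ::
  "nat set \<Rightarrow> nat set \<Rightarrow> nat set \<Rightarrow> (nat \<times> 'a \<times> nat) set \<Rightarrow> (nat \<Rightarrow> 'a) set" where
  "buchi_lang Q Qi Qf \<delta> =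
     {\<sigma>. \<exists>r::nat \<Rightarrow> nat. r 0 \<in> Qi \<and> (\<forall>n. (r n, \<sigma> n, r (Suc n)) \<in> \<delta>)
                      \<and> (\<exists>\<^sub>\<infinity>n. r n \<in> Qf)}"

definition omega_regular :: "(nat \<Rightarrow> 'a) set \<Rightarrow> bool" where
  "omega_regular L \<longleftrightarrow> (\<exists>Q Qi Qf \<delta>. finite Q \<and> Qi \<subseteq> Q \<and> Qf \<subseteq> Q \<and>
       \<delta> \<subseteq> Q \<times> UNIV \<times> Q \<and> L = buchi_lang Q Qi Qf \<delta>)"

inductive recfun :: "nat \<Rightarrow> (nat list \<Rightarrow> nat) \<Rightarrow> bool" where
  zero: "recfun n (\<lambda>_. 0)"
| succ: "recfun 1 (\<lambda>xs. Suc (hd xs))"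
| proj: "i < n \<Longrightarrow> recfun n (\<lambda>xs. xs ! i)"
| comp: "recfun m g \<Longrightarrow> length fs = m \<Longrightarrow> (\<forall>i<m. recfun n (fs ! i))
          \<Longrightarrow> recfun n (\<lambda>xs. g (map (\<lambda>f. f xs) fs))"
| prim: "recfun n g \<Longrightarrow> recfun (Suc (Suc n)) h
          \<Longrightarrow> recfun (Suc n) (\<lambda>ys. rec_nat (g (tl ys)) (\<lambda>y r. h (r # y # tl ys)) (hd ys))"
| mu: "recfun (Suc n) g \<Longrightarrow> (\<forall>xs. length xs = n \<longrightarrow> (\<exists>y. g (y # xs) = 0))
          \<Longrightarrow> recfun n (\<lambda>xs. LEAST y. g (y # xs) = 0)"
| ext: "recfun n f \<Longrightarrow> (\<forall>xs. length xs = n \<longrightarrow> f' xs = f xs) \<Longrightarrow> recfun n f'"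

definition prefix_code :: "(nat \<Rightarrow> nat) \<Rightarrow> nat \<Rightarrow> nat" where
  "prefix_code \<beta> n = list_encode (map \<beta> [0..<n])"

text \<open>Lightface Sigma^1_1 subsets of Sigma^N (Kleene normal form), with the recursive
  presentation induced by the injective coding to_nat of the finite alphabet.\<close>
definition Sigma11 :: "(nat \<Rightarrow> 'a::countable) set \<Rightarrow> bool" where
  "Sigma11 A \<longleftrightarrow> (\<exists>R. recfun 2 R \<and>
     (\<forall>\<sigma>. \<sigma> \<in> A \<longleftrightarrow> (\<exists>\<beta>::nat \<Rightarrow> nat. \<forall>n.
         R [prefix_code (to_nat \<circ> \<sigma>) n, prefix_code \<beta> n] = 0)))"

definition Pi11 :: "(nat \<Rightarrow> 'a::countable) set \<Rightarrow> bool" where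
  "Pi11 A \<longleftrightarrow> Sigma11 (- A)"

definition Delta11 :: "(nat \<Rightarrow> 'a::countable) set \<Rightarrow> bool" where
  "Delta11 A \<longleftrightarrow> Sigma11 A \<and> Pi11 A"

datatype top_kind = TC | TB | TA | Tdelta

definition tau :: "top_kind \<Rightarrow> (nat \<Rightarrow> 'a::countable) topology" where
  "tau z = (case z of
      TC \<Rightarrow> cantor_top
    | TB \<Rightarrow> topology_generated_by {L. omega_regular L}
    | TA \<Rightarrow> topology_generated_by {L. omega_regular L \<and> closedin cantor_top L}
    | Tdelta \<Rightarrow> topology_generated_by {L. Delta11 L})"

end

theory Submission
  imports Defs "HOL-Library.Ramsey"
begin

text \<open>
  Let \<open>\<D>\<close> be a countable family of sets of words, closed under complement and containing the
  cylinders. Sending a word to the subfamily of the members containing it embeds the topology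
  generated by \<open>\<D>\<close> into the Cantor space of subfamilies of \<open>\<D>\<close>. The generated topology is then
  zero-dimensional, and it is Polish once countably many conditions of the form
  ``if \<open>D \<subseteq> \<Union>\<E>\<close> and \<open>D\<close> belongs to the subfamily, so does a member of \<open>\<E>\<close>'' single out the image,
  since each of these conditions is open.

  For the \<open>\<omega>\<close>-regular languages such conditions build accepting runs piece by piece, and a Ramsey
  argument makes the complement of an \<open>\<omega>\<close>-regular language a union of \<open>\<omega>\<close>-regular languages. For
  the effectively Borel sets one uses Lusin separation: membership in a \<open>\<Delta>\<^sup>1\<^sub>1\<close> set is the
  value of a well-founded game recursive in the word, and the sets of words for which a given
  position of the game is won are again \<open>\<Delta>\<^sup>1\<^sub>1\<close>.
\<close>

subsection \<open>A criterion for generated topologies\<close>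

text \<open>The obstacle is countability. A subfamily that comes from a point satisfies the
  condition for every cover, but only countably many conditions may be imposed if the image is to be
  a G_delta set. So each generator needs a countable supply of covers that forces every subfamily
  obeying them and containing the generator to describe a point of it. The supply is read off from
  whatever certifies membership: a won position is covered by the positions after one move, a
  partial run by its extensions past one more final state, an open set by cylinders. Membership of
  the point is then rebuilt along the certificate, by induction on the game or by dependent choice
  along the run.

  The point itself is fixed by the cylinders. Enlarging the covers by finite families keeps them
  countable in number and allows every cover to be checked only on words that share a prefix with
  the point.

  For automata, complements are simply added to the generators. It then suffices that they are
  unions of old generators: this leaves the topology unchanged and supplies the covers for the new
  members.\<close>

lemma openin_generated_finite_Inter:
  assumes "openin (topology_generated_by \<D>) W" "x \<in> W"
  obtains \<F> where "finite \<F>" "\<F> \<subseteq> \<D>" "x \<in> \<Inter>\<F>" "\<Inter>\<F> \<subseteq> W"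
proof -
  have "generate_topology_on \<D> W"
    using assms(1) by (simp add: openin_topology_generated_by_iff)
  then have "\<exists>\<F>. finite \<F> \<and> \<F> \<subseteq> \<D> \<and> x \<in> \<Inter>\<F> \<and> \<Inter>\<F> \<subseteq> W"
    using assms(2)
  proof (induction arbitrary: x)
    case (Int a b)
    obtain F where "finite F" "F \<subseteq> \<D>" "x \<in> \<Inter>F" "\<Inter>F \<subseteq> a"
      using Int.IH(1)[of x] Int.prems by auto
    moreover obtain G where "finite G" "G \<subseteq> \<D>" "x \<in> \<Inter>G" "\<Inter>G \<subseteq> b"
      using Int.IH(2)[of x] Int.prems by auto
    ultimately show ?case by (intro exI[of _ "F \<union> G"]) auto
  next
    case (UN K)
    then obtain k where "k \<in> K" "x \<in> k" by blast
    then obtain F where "finite F" "F \<subseteq> \<D>" "x \<in> \<Inter>F" "\<Inter>F \<subseteq> k"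
      using UN.IH by meson
    then show ?case using \<open>k \<in> K\<close> by (intro exI[of _ F]) auto
  next
    case (Basis s)
    then show ?case by (intro exI[of _ "{s}"]) auto
  qed auto
  then show thesis using that by blast
qed

lemma Union_compl_closed:
  assumes "\<D> \<noteq> {}" "\<And>D. D \<in> \<D> \<Longrightarrow> - D \<in> \<D>"
  shows "\<Union>\<D> = UNIV"
proof -
  obtain D where "D \<in> \<D>" using assms(1) by blast
  then have "D \<union> - D \<subseteq> \<Union>\<D>" using assms(2) by blast
  then show ?thesis by auto
qed

text \<open>Members and their complements are both open, so the finite intersections of members form
  a base of clopen sets.\<close>

lemma zero_dimensional_generated:
  assumes "\<D> \<noteq> {}" "\<And>D. D \<in> \<D> \<Longrightarrow> - D \<in> \<D>"
  shows "zero_dimensional (topology_generated_by \<D>)"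
proof -
  let ?X = "topology_generated_by \<D>"
  have top: "topspace ?X = UNIV"
    using Union_compl_closed[OF assms] by simp
  have clopen: "closedin ?X D \<and> openin ?X D" if "D \<in> \<D>" for D
    using that assms(2) topology_generated_by_Basis[of _ \<D>]
    by (simp add: closedin_def top Compl_eq_Diff_UNIV[symmetric] del: topology_generated_by_topspace)
  have "\<exists>U. (closedin ?X U \<and> openin ?X U) \<and> x \<in> U \<and> U \<subseteq> W"
    if W: "openin ?X W" "x \<in> W" for W x
  proof -
    obtain \<F> where F: "finite \<F>" "\<F> \<subseteq> \<D>" "x \<in> \<Inter>\<F>" "\<Inter>\<F> \<subseteq> W"
      using openin_generated_finite_Inter[OF W] .
    have "closedin ?X (\<Inter>\<F>) \<and> openin ?X (\<Inter>\<F>)"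
    proof (cases "\<F> = {}")
      case True
      then show ?thesis using top by (metis Inter_empty closedin_topspace openin_topspace)
    next
      case False
      then show ?thesis
        using F clopen by (intro conjI closedin_Inter openin_Inter) auto
    qed
    then show ?thesis using F by blast
  qed
  then show ?thesis
    unfolding zero_dimensional_def dimension_le_0_neighbourhood_base_of_clopen
    by (subst open_neighbourhood_base_of) auto
qed

lemma second_countable_generated:
  assumes "countable \<D>" "\<Union>\<D> = UNIV"
  shows "second_countable (topology_generated_by \<D>)"
proof -
  let ?X = "topology_generated_by \<D>"
  let ?B = "Inter ` {\<F>. finite \<F> \<and> \<F> \<subseteq> \<D>}"
  have top: "topspace ?X = UNIV"
    using assms by simp
  have "openin ?X V" if "V \<in> ?B" for V
  proof -
    from that obtain \<F> where F: "finite \<F>" "\<F> \<subseteq> \<D>" "V = \<Inter>\<F>" by auto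
    show ?thesis
    proof (cases "\<F> = {}")
      case True
      then show ?thesis using top F by (metis Inter_empty openin_topspace)
    next
      case False
      then show ?thesis
        using F topology_generated_by_Basis[of _ \<D>] by (auto intro!: openin_Inter)
    qed
  qed
  moreover have "\<exists>V\<in>?B. x \<in> V \<and> V \<subseteq> U" if U: "openin ?X U" "x \<in> U" for U x
  proof -
    obtain \<F> where "finite \<F>" "\<F> \<subseteq> \<D>" "x \<in> \<Inter>\<F>" "\<Inter>\<F> \<subseteq> U"
      using openin_generated_finite_Inter[OF U] .
    then show ?thesis by (intro bexI[of _ "\<Inter>\<F>"]) auto
  qed
  moreover have "countable ?B"
    using assms(1) by (intro countable_image countable_Collect_finite_subset)
  ultimately show ?thesis
    unfolding second_countable_def by (intro exI[of _ ?B]) auto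
qed

text \<open>By Alexandrov's theorem a G_delta subspace of a completely metrizable space is
  completely metrizable. Subfamilies are handled as characteristic functions, that is, as points of
  a countable power of the two-point space. \<open>sep\<close> makes the map from points to
  subfamilies injective; \<open>complete\<close> makes it onto the G_delta set.\<close>

lemma Polish_generated:
  assumes count: "countable \<D>" and ne: "\<D> \<noteq> {}"
    and compl: "\<And>D. D \<in> \<D> \<Longrightarrow> - D \<in> \<D>"
    and K: "countable \<K>" "\<K> \<subseteq> Pow \<D>"
    and sep: "\<And>x y. x \<noteq> y \<Longrightarrow> \<exists>D\<in>\<D>. x \<in> D \<and> y \<notin> D"
    and complete: "\<And>Y. \<lbrakk>Y \<subseteq> \<D>; \<And>D. D \<in> \<D> \<Longrightarrow> D \<in> Y \<longleftrightarrow> - D \<notin> Y;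
        \<And>D E. \<lbrakk>D \<in> Y; E \<in> \<K>; D \<subseteq> \<Union>E\<rbrakk> \<Longrightarrow> E \<inter> Y \<noteq> {}\<rbrakk> \<Longrightarrow> \<exists>x. \<forall>D\<in>Y. x \<in> D"
  shows "Polish_space (topology_generated_by \<D>)"
proof -
  let ?X = "topology_generated_by \<D>"
  have UD: "\<Union>\<D> = UNIV"
    using ne compl by (rule Union_compl_closed)
  then have top: "topspace ?X = UNIV" by simp
  define P where "P = product_topology (\<lambda>_. discrete_topology (UNIV :: bool set)) \<D>"
  have topP: "topspace P = extensional \<D>"
    by (auto simp: P_def PiE_def)
  have comp_open: "openin P {f \<in> topspace P. f D = b}" if "D \<in> \<D>" for D b
  proof -
    have "continuous_map P (discrete_topology (UNIV :: bool set)) (\<lambda>f. f D)"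
      unfolding P_def by (rule continuous_map_product_projection[OF that])
    from openin_continuous_map_preimage[OF this, of "{b}"] show ?thesis by (simp only: singleton_iff openin_discrete_topology subset_UNIV simp_thms)
  qed
  define C where "C = {(D, E). D \<in> \<D> \<and> E \<in> \<K> \<and> D \<subseteq> \<Union>E}"
  define U1 where "U1 D = {f \<in> topspace P. f D \<noteq> f (- D)}" for D
  define U2 where "U2 = (\<lambda>(D, E). {f \<in> topspace P. f D \<longrightarrow> (\<exists>G\<in>E. f G)})"
  have "openin P (U1 D)" if "D \<in> \<D>" for D
  proof -
    have "U1 D = ({f \<in> topspace P. f D = True} \<inter> {f \<in> topspace P. f (- D) = False})
       \<union> ({f \<in> topspace P. f D = False} \<inter> {f \<in> topspace P. f (- D) = True})"
      by (auto simp: U1_def)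
    then show ?thesis
      using comp_open[OF that] comp_open[OF compl[OF that]] by (simp only: openin_Int openin_Un)
  qed
  moreover have "openin P (U2 c)" if cC: "c \<in> C" for c
  proof -
    obtain D E where c: "c = (D, E)" "D \<in> \<D>" "E \<subseteq> \<D>"
      using cC K by (auto simp: C_def)
    then have "U2 c = {f \<in> topspace P. f D = False} \<union> (\<Union>G\<in>E. {f \<in> topspace P. f G = True})"
      by (auto simp: U2_def)
    moreover have "openin P (\<Union>G\<in>E. {f \<in> topspace P. f G = True})"
      using comp_open c by (intro openin_Union) blast
    ultimately show ?thesis
      using comp_open[OF c(2), of False] by (simp only: openin_Un)
  qed
  moreover have "countable C"
    by (rule countable_subset[of _ "\<D> \<times> \<K>"]) (auto simp: C_def count K)
  ultimately have "gdelta_in P (\<Inter>(U1 ` \<D> \<union> U2 ` C))"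
    using ne count by (intro gdelta_in_Inter) (auto intro: open_imp_gdelta_in)
  moreover define S where "S = \<Inter>(U1 ` \<D> \<union> U2 ` C)"
  ultimately have gS: "gdelta_in P S" by simp
  have "completely_metrizable_space P"
    unfolding P_def completely_metrizable_space_product_topology
    by (auto simp: completely_metrizable_space_discrete_topology intro: countable_subset[OF _ count])
  then have cS: "completely_metrizable_space (subtopology P S)"
    using gS by (rule completely_metrizable_space_gdelta_in)
  define e where "e x = restrict (\<lambda>D. x \<in> D) \<D>" for x
  have e_in: "e x \<in> S" for x
  proof -
    have "e x \<in> topspace P" by (auto simp: e_def topP)
    then have "e x \<in> U1 D" if "D \<in> \<D>" for D
      using that compl[OF that] by (simp add: U1_def e_def)
    moreover have "e x \<in> U2 c" if "c \<in> C" for c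
    proof -
      obtain D E where c: "c = (D, E)" "D \<in> \<D>" "E \<subseteq> \<D>" "D \<subseteq> \<Union>E"
        using \<open>c \<in> C\<close> K(2) by (auto simp: C_def)
      have "\<exists>G\<in>E. e x G" if "e x D"
      proof -
        have "x \<in> \<Union>E" using that c by (auto simp: e_def)
        then obtain G where "G \<in> E" "x \<in> G" by blast
        then show ?thesis using c by (intro bexI[of _ G]) (auto simp: e_def)
      qed
      then show ?thesis using \<open>e x \<in> topspace P\<close> by (simp add: U2_def c)
    qed
    ultimately show ?thesis unfolding S_def by blast
  qed
  have inj: "x = y" if "e x = e y" for x y
  proof (rule ccontr)
    assume "x \<noteq> y"
    then obtain D where "D \<in> \<D>" "x \<in> D" "y \<notin> D" using sep by blast
    then show False using fun_cong[OF that, of D] by (simp add: e_def)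
  qed
  have surj: "\<exists>x. e x = f" if f: "f \<in> S" for f
  proof -
    have fP: "f \<in> topspace P" using gS f gdelta_in_subset by blast
    define Y where "Y = {D \<in> \<D>. f D}"
    have Y: "D \<in> Y \<longleftrightarrow> - D \<notin> Y" if "D \<in> \<D>" for D
    proof -
      have "f \<in> U1 D" using f that by (auto simp: S_def)
      then show ?thesis using that compl by (auto simp: Y_def U1_def)
    qed
    have "\<exists>x. \<forall>D\<in>Y. x \<in> D"
    proof (rule complete)
      show "E \<inter> Y \<noteq> {}" if "D \<in> Y" "E \<in> \<K>" "D \<subseteq> \<Union>E" for D E
      proof -
        have "(D, E) \<in> C" using that by (auto simp: C_def Y_def)
        then have "f \<in> U2 (D, E)" using f unfolding S_def by blast
        then show ?thesis using that K by (auto simp: Y_def U2_def)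
      qed
    qed (use Y in \<open>auto simp: Y_def\<close>)
    then obtain x where x: "\<And>D. D \<in> Y \<Longrightarrow> x \<in> D" by blast
    \<comment> \<open>Lying in every member of \<open>Y\<close> settles the remaining sets too: if
      \<open>f D\<close> is false, then \<open>- D\<close> is in \<open>Y\<close>.\<close>
    have "x \<in> D \<longleftrightarrow> f D" if "D \<in> \<D>" for D
      using x[of D] x[of "- D"] Y[OF that] that by (auto simp: Y_def)
    then have "e x = f"
      using fP by (simp add: fun_eq_iff e_def topP extensional_def restrict_def)
    then show ?thesis by blast
  qed
  define g where "g = inv e"
  have ge: "g (e x) = x" for x
    by (simp add: g_def inv_f_f inj injI)
  have eg: "e (g f) = f" if "f \<in> S" for f
    using surj[OF that] ge by metis
  have topS: "topspace (subtopology P S) = S"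
    using gS gdelta_in_subset by fastforce
  have "continuous_map ?X P e"
    unfolding P_def
  proof (subst continuous_map_componentwise, intro conjI ballI)
    show "e ` topspace ?X \<subseteq> extensional \<D>" by (auto simp: e_def)
    fix D assume D: "D \<in> \<D>"
    have "openin ?X {x. e x D \<in> U}" for U
    proof -
      have "{x. e x D \<in> U} = (if True \<in> U then D else {}) \<union> (if False \<in> U then - D else {})"
        (is "?L = ?R")
      proof (intro set_eqI)
        fix x show "x \<in> ?L \<longleftrightarrow> x \<in> ?R"
          using D by (cases "x \<in> D") (simp_all add: e_def)
      qed
      then show ?thesis using D compl by (simp add: openin_Un topology_generated_by_Basis)
    qed
    then show "continuous_map ?X (discrete_topology UNIV) (\<lambda>x. e x D)"
      using UD by (simp add: continuous_map_def)
  qed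
  moreover have "continuous_map (subtopology P S) ?X g"
  proof (rule continuous_on_generated_topo)
    fix D assume D: "D \<in> \<D>"
    \<comment> \<open>Under the embedding a generator becomes a subbasic set of the product.\<close>
    have "g -` D \<inter> topspace (subtopology P S) = {f \<in> topspace P. f D = True} \<inter> S"
      unfolding topS
    proof (intro equalityI subsetI)
      fix f assume "f \<in> g -` D \<inter> S"
      then have f: "g f \<in> D" "f \<in> S" by auto
      then have "e (g f) D" using D by (simp add: e_def)
      then show "f \<in> {f \<in> topspace P. f D = True} \<inter> S"
        using eg f gdelta_in_subset[OF gS] by auto
    next
      fix f assume "f \<in> {f \<in> topspace P. f D = True} \<inter> S"
      then have "e (g f) D" "f \<in> S" using eg[of f] by auto
      then show "f \<in> g -` D \<inter> S" using D by (auto simp: e_def)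
    qed
    then show "openin (subtopology P S) (g -` D \<inter> topspace (subtopology P S))"
      using openin_subtopology_Int[OF comp_open[OF D, of True]] by (simp only:)
  qed (use UD in auto)
  ultimately have "homeomorphic_maps ?X (subtopology P S) e g"
    unfolding homeomorphic_maps_def
    using e_in ge eg topS by (auto simp: continuous_map_in_subtopology)
  then have "?X homeomorphic_space subtopology P S"
    unfolding homeomorphic_space_def by blast
  then have "completely_metrizable_space ?X"
    using cS homeomorphic_completely_metrizable_space by blast
  moreover have "separable_space ?X"
    using second_countable_generated[OF count UD] by (rule second_countable_imp_separable_space)
  ultimately show ?thesis by (simp add: Polish_space_def)
qed

section \<open>Families of sets of words that contain the cylinders\<close>

definition cyl :: "nat \<Rightarrow> 'a \<Rightarrow> (nat \<Rightarrow> 'a) set" where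
  "cyl m a = {\<sigma>. \<sigma> m = a}"

text \<open>\<open>Y\<close> is a candidate for the subfamily of those members of \<open>\<D>\<close> that contain \<open>x\<close>.\<close>

definition adequate ::
  "(nat \<Rightarrow> 'a) set set \<Rightarrow> (nat \<Rightarrow> 'a) set set set \<Rightarrow> (nat \<Rightarrow> 'a) set set \<Rightarrow> (nat \<Rightarrow> 'a) \<Rightarrow> bool" where
  "adequate \<D> \<K> Y x \<longleftrightarrow> Y \<subseteq> \<D> \<and> (\<forall>D\<in>\<D>. D \<in> Y \<longleftrightarrow> - D \<notin> Y) \<and> (\<forall>m a. cyl m a \<in> Y \<longleftrightarrow> x m = a) \<and>
     (\<forall>D E F. D \<in> Y \<longrightarrow> E \<in> insert {} \<K> \<longrightarrow> finite F \<longrightarrow> F \<subseteq> \<D> \<longrightarrow> D \<subseteq> \<Union>E \<union> \<Union>F \<longrightarrow> (\<exists>G\<in>E \<union> F. G \<in> Y))"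

lemma adequate_finite_extension_cover:
  assumes "adequate \<D> \<K> Y x" "D \<in> Y" "E \<in> insert {} \<K>" "finite F" "F \<subseteq> \<D>" "D \<subseteq> \<Union>E \<union> \<Union>F"
  shows "\<exists>G\<in>E \<union> F. G \<in> Y"
  by (rule assms(1)[unfolded adequate_def, THEN conjunct2, THEN conjunct2, THEN conjunct2,
        rule_format, OF assms(2-6)])

lemma adequate_mono:
  assumes "adequate \<D> \<K> Y x" "\<K>' \<subseteq> \<K>"
  shows "adequate \<D> \<K>' Y x"
  unfolding adequate_def
proof (intro conjI allI impI)
  fix D E F
  assume *: "D \<in> Y" "E \<in> insert {} \<K>'" "finite F" "F \<subseteq> \<D>" "D \<subseteq> \<Union>E \<union> \<Union>F"
  then have "E \<in> insert {} \<K>" using assms(2) by blast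
  from adequate_finite_extension_cover[OF assms(1) *(1) this *(3-5)]
  show "\<exists>G\<in>E \<union> F. G \<in> Y" .
qed (use assms(1) in \<open>simp_all add: adequate_def\<close>)

lemma adequate_cyl: "adequate \<D> \<K> Y x \<Longrightarrow> cyl m a \<in> Y \<longleftrightarrow> x m = a"
  unfolding adequate_def by (elim conjE) (erule allE, erule allE)

lemma adequate_Compl: "adequate \<D> \<K> Y x \<Longrightarrow> D \<in> \<D> \<Longrightarrow> D \<in> Y \<longleftrightarrow> - D \<notin> Y"
  unfolding adequate_def by (elim conjE) (rule bspec)

lemma adequate_cover:
  assumes "adequate \<D> \<K> Y x" "D \<in> Y" "E \<in> \<K>" "D \<subseteq> \<Union>E"
  shows "\<exists>G\<in>E. G \<in> Y"
  using adequate_finite_extension_cover[OF assms(1,2), of E "{}"] assms(3,4) by simp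

lemma adequate_subset:
  assumes "adequate \<D> \<K> Y x" "D \<in> Y" "G \<in> \<D>" "D \<subseteq> G"
  shows "G \<in> Y"
  using adequate_finite_extension_cover[OF assms(1,2), of "{}" "{G}"] assms(3,4) by simp

text \<open>A word that leaves the first \<open>k\<close> letters of \<open>x\<close> lies in the
  complement of some \<open>cyl m (x m)\<close> with \<open>m < k\<close>. These finitely many
  complements join \<open>F\<close>; none of them is in \<open>Y\<close>, so the member found comes
  from the original cover. This is the purpose of the finite families in
  \<open>adequate\<close>.\<close>

lemma adequate_local_cover:
  assumes ad: "adequate \<D> \<K> Y x" and "D \<in> Y" "E \<in> insert {} \<K>" "finite F" "F \<subseteq> \<D>"
    and cyl: "\<And>m a. cyl m a \<in> \<D>" and compl: "\<And>D. D \<in> \<D> \<Longrightarrow> - D \<in> \<D>"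
    and sub: "\<And>\<sigma>. \<sigma> \<in> D \<Longrightarrow> (\<forall>m<k. \<sigma> m = x m) \<Longrightarrow> \<sigma> \<in> \<Union>E \<union> \<Union>F"
  shows "\<exists>G\<in>E \<union> F. G \<in> Y"
proof -
  let ?N = "(\<lambda>m. - cyl m (x m)) ` {..<k}"
  have "D \<subseteq> \<Union>E \<union> \<Union>(F \<union> ?N)"
  proof
    fix \<sigma> assume "\<sigma> \<in> D"
    show "\<sigma> \<in> \<Union>E \<union> \<Union>(F \<union> ?N)"
    proof (cases "\<forall>m<k. \<sigma> m = x m")
      case True
      then have "\<sigma> \<in> \<Union>E \<union> \<Union>F" using sub \<open>\<sigma> \<in> D\<close> by blast
      then show ?thesis by blast
    next
      case False
      then obtain m where "m < k" "\<sigma> \<in> - cyl m (x m)" by (auto simp: cyl_def)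
      then show ?thesis by blast
    qed
  qed
  moreover have "finite (F \<union> ?N)" "F \<union> ?N \<subseteq> \<D>"
    using assms by auto
  ultimately obtain G where G: "G \<in> E \<union> (F \<union> ?N)" "G \<in> Y"
    using adequate_finite_extension_cover[OF ad \<open>D \<in> Y\<close> \<open>E \<in> insert {} \<K>\<close>] by meson
  moreover have "- cyl m (x m) \<notin> Y" for m
    using adequate_cyl[OF ad] adequate_Compl[OF ad cyl] by blast
  ultimately show ?thesis by blast
qed

text \<open>Each member may bring its own covers: countably many countable supplies are still
  countable, and \<open>adequate_mono\<close> restricts the joint condition back to the supply of a
  single member.\<close>

lemma Polish_words:
  fixes \<D> :: "(nat \<Rightarrow> 'a::countable) set set"
  assumes count: "countable \<D>" and compl: "\<And>D. D \<in> \<D> \<Longrightarrow> - D \<in> \<D>"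
    and cyl: "\<And>m a. cyl m a \<in> \<D>"
    and wit: "\<And>D. D \<in> \<D> \<Longrightarrow> \<exists>\<K>. countable \<K> \<and> \<K> \<subseteq> Pow \<D> \<and>
        (\<forall>Y x. adequate \<D> \<K> Y x \<longrightarrow> D \<in> Y \<longrightarrow> x \<in> D)"
  shows "Polish_space (topology_generated_by \<D>) \<and> zero_dimensional (topology_generated_by \<D>)"
proof
  have ne: "\<D> \<noteq> {}" using cyl by blast
  then show "zero_dimensional (topology_generated_by \<D>)"
    using compl by (rule zero_dimensional_generated)
  obtain KK where KK: "\<And>D. D \<in> \<D> \<Longrightarrow> countable (KK D) \<and> KK D \<subseteq> Pow \<D> \<and>
        (\<forall>Y x. adequate \<D> (KK D) Y x \<longrightarrow> D \<in> Y \<longrightarrow> x \<in> D)"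
    using wit by metis
  \<comment> \<open>The covers of the whole space by the cylinders at one position are added; they
    produce the letters of \<open>x\<close>.\<close>
  define \<K> where "\<K> = \<Union>(KK ` \<D>) \<union> range (\<lambda>m. range (cyl m))"
  \<comment> \<open>A countable family has only countably many finite subfamilies, so the enlarged
    covers remain countable in number.\<close>
  let ?K = "(\<lambda>(E, F). E \<union> F) ` (insert {} \<K> \<times> {F. finite F \<and> F \<subseteq> \<D>})"
  show "Polish_space (topology_generated_by \<D>)"
  proof (rule Polish_generated[OF count ne compl, of ?K])
    show "countable ?K"
    proof -
      have "countable \<K>" using KK count unfolding \<K>_def by simp
      then show ?thesis
        using countable_Collect_finite_subset[OF count]
        by (intro countable_image countable_SIGMA countable_insert) auto
    qed
    show "?K \<subseteq> Pow \<D>"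
    proof -
      have "\<K> \<subseteq> Pow \<D>" using KK cyl unfolding \<K>_def by auto
      then show ?thesis by auto
    qed
    show "\<exists>D\<in>\<D>. x \<in> D \<and> y \<notin> D" if "x \<noteq> y" for x y
    proof -
      from that obtain m where "x m \<noteq> y m" by blast
      then show ?thesis using cyl[of m "x m"] by (auto simp: cyl_def)
    qed
    fix Y assume Y: "Y \<subseteq> \<D>" "\<And>D. D \<in> \<D> \<Longrightarrow> D \<in> Y \<longleftrightarrow> - D \<notin> Y"
      "\<And>D E. \<lbrakk>D \<in> Y; E \<in> ?K; D \<subseteq> \<Union>E\<rbrakk> \<Longrightarrow> E \<inter> Y \<noteq> {}"
    have cover: "\<exists>G\<in>E \<union> F. G \<in> Y"
      if "D \<in> Y" "E \<in> insert {} \<K>" "finite F" "F \<subseteq> \<D>" "D \<subseteq> \<Union>E \<union> \<Union>F" for D E F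
    proof -
      have "E \<union> F \<in> ?K" using that by (intro image_eqI[of _ _ "(E, F)"]) auto
      moreover have "D \<subseteq> \<Union>(E \<union> F)" using that by auto
      ultimately have "(E \<union> F) \<inter> Y \<noteq> {}" using that(1) by (rule_tac Y(3))
      then show ?thesis by blast
    qed
    \<comment> \<open>Every cover condition starts from a member of \<open>Y\<close>. One exists
      because \<open>Y\<close> contains a given cylinder or its complement.\<close>
    obtain D0 where D0: "D0 \<in> Y"
      using Y(2)[OF cyl[of 0 undefined]] by metis
    have "\<exists>a. cyl m a \<in> Y" for m
    proof -
      have "D0 \<subseteq> \<Union>(range (cyl m)) \<union> \<Union>{}" by (auto simp: cyl_def)
      then show ?thesis
        using cover[of D0 "range (cyl m)" "{}"] D0 by (auto simp: \<K>_def)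
    qed
    then obtain x where x: "\<And>m. cyl m (x m) \<in> Y" by metis
    have uniq: "a = b" if "cyl m a \<in> Y" "cyl m b \<in> Y" for m a b
    proof (rule ccontr)
      assume "a \<noteq> b"
      then have "cyl m a \<subseteq> \<Union>{} \<union> \<Union>{- cyl m b}" by (auto simp: cyl_def)
      then have "- cyl m b \<in> Y"
        using cover[of "cyl m a" "{}" "{- cyl m b}"] that cyl compl by auto
      then show False using Y(2) that cyl by blast
    qed
    have "adequate \<D> \<K> Y x"
      unfolding adequate_def
    proof (intro conjI allI ballI impI)
      show "(cyl m a \<in> Y) = (x m = a)" for m a
        using x uniq by blast
    qed (use Y(1,2) cover in auto)
    then have "adequate \<D> (KK D) Y x" if "D \<in> \<D>" for D
      using that by (rule_tac adequate_mono) (auto simp: \<K>_def)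
    then show "\<exists>x. \<forall>D\<in>Y. x \<in> D"
      using KK Y(1) by blast
  qed
qed

subsection \<open>Recursive functions\<close>

lemma recfun_cong:
  assumes "recfun n f" "\<And>xs. length xs = n \<Longrightarrow> f' xs = f xs"
  shows "recfun n f'"
  using recfun.ext[OF assms(1)] assms(2) by blast

lemma recfun_comp_list:
  assumes "recfun m g" "length fs = m" "\<And>f. f \<in> set fs \<Longrightarrow> recfun n f"
  shows "recfun n (\<lambda>xs. g (map (\<lambda>f. f xs) fs))"
  using assms by (intro recfun.comp) auto

text \<open>In the step function of \<open>prim\<close> the parameters stand behind the accumulator
  and the counter; this lets a function of the parameters ignore such leading arguments.\<close>

lemma recfun_drop:
  assumes "recfun n g" "k + n = m"
  shows "recfun m (\<lambda>zs. g (drop k zs))"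
proof (rule recfun_cong)
  let ?fs = "map (\<lambda>i zs. zs ! (k + i)) [0..<n]"
  show "recfun m (\<lambda>xs. g (map (\<lambda>f. f xs) ?fs))"
    by (rule recfun_comp_list[OF assms(1)]) (use assms(2) in \<open>auto intro: recfun.proj\<close>)
  fix zs :: "nat list" assume "length zs = m"
  then have "map (\<lambda>f. f zs) ?fs = drop k zs"
    using assms(2) by (intro nth_equalityI) auto
  then show "g (drop k zs) = g (map (\<lambda>f. f zs) ?fs)" by simp
qed

lemma recfun_tl: "recfun n g \<Longrightarrow> recfun (Suc n) (\<lambda>zs. g (tl zs))"
  using recfun_drop[of n g 1 "Suc n"] by (simp add: drop_Suc)

lemma recfun_Cons_drop:
  assumes "recfun (Suc n) g" "recfun m e" "k + n = m"
  shows "recfun m (\<lambda>zs. g (e zs # drop k zs))"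
proof (rule recfun_cong)
  let ?fs = "e # map (\<lambda>i zs. zs ! (k + i)) [0..<n]"
  show "recfun m (\<lambda>xs. g (map (\<lambda>f. f xs) ?fs))"
    by (rule recfun_comp_list[OF assms(1)]) (use assms(2,3) in \<open>auto intro: recfun.proj\<close>)
  fix zs :: "nat list" assume "length zs = m"
  then have "map (\<lambda>f. f zs) ?fs = e zs # drop k zs"
    using assms(3) by (intro nth_equalityI) (auto simp: nth_Cons')
  then show "g (e zs # drop k zs) = g (map (\<lambda>f. f zs) ?fs)" by simp
qed

lemma recfun_comp1:
  assumes "recfun (Suc 0) (\<lambda>xs. g (xs ! 0))" "recfun n a"
  shows "recfun n (\<lambda>xs. g (a xs))"
  using recfun_comp_list[OF assms(1), of "[a]" n] assms(2) by simp

lemma recfun_comp2: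
  assumes "recfun 2 (\<lambda>xs. g (xs ! 0) (xs ! 1))" "recfun n a" "recfun n b"
  shows "recfun n (\<lambda>xs. g (a xs) (b xs))"
  using recfun_comp_list[OF assms(1), of "[a, b]" n] assms(2,3) by auto

lemma recfun_apply2:
  assumes "recfun 2 R" "recfun n a" "recfun n b"
  shows "recfun n (\<lambda>xs. R [a xs, b xs])"
  using recfun_comp_list[OF assms(1), of "[a, b]" n] assms(2,3) by auto

lemma recfun_comp3:
  assumes "recfun 3 (\<lambda>xs. g (xs ! 0) (xs ! 1) (xs ! 2))" "recfun n a" "recfun n b" "recfun n c"
  shows "recfun n (\<lambda>xs. g (a xs) (b xs) (c xs))"
  using recfun_comp_list[OF assms(1), of "[a, b, c]" n] assms(2-4) by auto

lemma recfun_rec: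
  assumes "recfun n a" "recfun (Suc (Suc n)) b" "recfun n e"
  shows "recfun n (\<lambda>xs. rec_nat (a xs) (\<lambda>y r. b (r # y # xs)) (e xs))"
  using recfun_Cons_drop[OF recfun.prim[OF assms(1,2)] assms(3), of 0] by simp

lemma recfun_hd: "0 < n \<Longrightarrow> recfun n hd"
  by (rule recfun_cong[OF recfun.proj[of 0 n]]) (auto simp: hd_conv_nth)

lemma recfun_nth_tl: "Suc i < n \<Longrightarrow> recfun n (\<lambda>zs. tl zs ! i)"
  by (rule recfun_cong[OF recfun.proj[of "Suc i" n]]) (auto simp: nth_tl)

lemma recfun_Suc:
  assumes "recfun n a"
  shows "recfun n (\<lambda>xs. Suc (a xs))"
proof (rule recfun_comp1[OF _ assms, of Suc])
  show "recfun (Suc 0) (\<lambda>xs. Suc (xs ! 0))"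
    by (rule recfun_cong[OF recfun.succ[unfolded One_nat_def]]) (auto simp: length_Suc_conv)
qed

lemma recfun_const: "recfun n (\<lambda>_. k)"
  by (induction k) (auto intro: recfun.zero recfun_Suc)

lemma recfun_add:
  assumes "recfun n a" "recfun n b"
  shows "recfun n (\<lambda>xs. a xs + b xs)"
proof (rule recfun_comp2[OF _ assms])
  have *: "rec_nat b (\<lambda>y r. Suc r) a = a + b" for a b by (induction a) auto
  show "recfun 2 (\<lambda>xs. xs ! 0 + xs ! 1)"
    using recfun_rec[of 2 "\<lambda>xs. xs ! 1" "\<lambda>zs. Suc (zs ! 0)" "\<lambda>xs. xs ! 0"]
    by (simp add: * recfun.proj recfun_Suc)
qed

lemma recfun_pred:
  assumes "recfun n a"
  shows "recfun n (\<lambda>xs. a xs - 1)"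
proof (rule recfun_comp1[OF _ assms])
  have *: "rec_nat 0 (\<lambda>y r. y) a = a - 1" for a by (cases a) auto
  show "recfun (Suc 0) (\<lambda>xs. xs ! 0 - 1)"
    using recfun_rec[of 1 "\<lambda>_. 0" "\<lambda>zs. zs ! 1" "\<lambda>xs. xs ! 0"]
    by (simp add: * recfun.proj recfun.zero del: One_nat_def) simp
qed

lemma recfun_diff:
  assumes "recfun n a" "recfun n b"
  shows "recfun n (\<lambda>xs. a xs - b xs)"
proof (rule recfun_comp2[OF _ assms])
  have *: "rec_nat a (\<lambda>y r. r - 1) b = a - b" for a b by (induction b) auto
  show "recfun 2 (\<lambda>xs. xs ! 0 - xs ! 1)"
    using recfun_rec[of 2 "\<lambda>xs. xs ! 0" "\<lambda>zs. zs ! 0 - 1" "\<lambda>xs. xs ! 1"]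
    by (simp add: * recfun.proj recfun_pred del: One_nat_def)
qed

lemma recfun_if0:
  assumes "recfun n a" "recfun n b" "recfun n c"
  shows "recfun n (\<lambda>xs. if a xs = 0 then b xs else c xs)"
proof (rule recfun_comp3[OF _ assms])
  have *: "rec_nat b (\<lambda>y r. c) a = (if a = 0 then b else c)" for a b c :: nat by (cases a) auto
  show "recfun 3 (\<lambda>xs. if xs ! 0 = 0 then xs ! 1 else xs ! 2)"
    using recfun_rec[of 3 "\<lambda>xs. xs ! 1" "\<lambda>zs. zs ! 4" "\<lambda>xs. xs ! 0"]
    by (simp add: * recfun.proj cong: if_cong)
qed

text \<open>Truth is coded by 0, the value that \<open>mu\<close> searches for and that
  \<open>Sigma11\<close> tests.\<close>

definition recpred :: "nat \<Rightarrow> (nat list \<Rightarrow> bool) \<Rightarrow> bool" where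
  "recpred n P \<longleftrightarrow> recfun n (\<lambda>xs. if P xs then 0 else 1)"

lemma recpred_eq0: "recfun n a \<Longrightarrow> recpred n (\<lambda>xs. a xs = 0)"
  unfolding recpred_def by (intro recfun_if0 recfun_const)

lemma recfun_if:
  assumes "recpred n P" "recfun n b" "recfun n c"
  shows "recfun n (\<lambda>xs. if P xs then b xs else c xs)"
  by (rule recfun_cong[OF recfun_if0[OF assms(1)[unfolded recpred_def] assms(2,3)]]) simp

lemma recpred_if:
  assumes "recpred n P" "recpred n Q" "recpred n Q'"
  shows "recpred n (\<lambda>xs. if P xs then Q xs else Q' xs)"
proof -
  have "recfun n (\<lambda>xs. if P xs then (if Q xs then 0 else 1) else (if Q' xs then 0 else (1::nat)))"
    using assms(2,3) unfolding recpred_def by (rule recfun_if[OF assms(1)])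
  then show ?thesis
    unfolding recpred_def by (rule recfun_cong) auto
qed

lemma recpred_cong:
  assumes "recpred n P" "\<And>xs. Q xs = P xs"
  shows "recpred n Q"
  using assms by presburger

lemma recpred_const: "recpred n (\<lambda>_. b)"
  unfolding recpred_def by (rule recfun_const)

lemma recpred_not: "recpred n P \<Longrightarrow> recpred n (\<lambda>xs. \<not> P xs)"
  by (rule recpred_cong[OF recpred_if[of n P "\<lambda>_. False" "\<lambda>_. True"]]) (auto simp: recpred_const)

lemma recpred_conj: "recpred n P \<Longrightarrow> recpred n Q \<Longrightarrow> recpred n (\<lambda>xs. P xs \<and> Q xs)"
  by (rule recpred_cong[OF recpred_if[of n P Q "\<lambda>_. False"]]) (auto simp: recpred_const)

lemma recpred_disj: "recpred n P \<Longrightarrow> recpred n Q \<Longrightarrow> recpred n (\<lambda>xs. P xs \<or> Q xs)"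
  by (rule recpred_cong[OF recpred_if[of n P "\<lambda>_. True" Q]]) (auto simp: recpred_const)

lemma recpred_imp: "recpred n P \<Longrightarrow> recpred n Q \<Longrightarrow> recpred n (\<lambda>xs. P xs \<longrightarrow> Q xs)"
  by (rule recpred_cong[OF recpred_if[of n P Q "\<lambda>_. True"]]) (auto simp: recpred_const)

lemma recpred_eq:
  assumes "recfun n a" "recfun n b"
  shows "recpred n (\<lambda>xs. a xs = b xs)"
proof -
  have "recpred n (\<lambda>xs. (a xs - b xs) + (b xs - a xs) = 0)"
    by (intro recpred_eq0 recfun_add recfun_diff assms)
  moreover have "(\<lambda>xs. (a xs - b xs) + (b xs - a xs) = 0) = (\<lambda>xs. a xs = b xs)"
    by auto
  ultimately show ?thesis by simp
qed

lemma recpred_less: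
  assumes "recfun n a" "recfun n b"
  shows "recpred n (\<lambda>xs. a xs < b xs)"
proof -
  have "recpred n (\<lambda>xs. Suc (a xs) - b xs = 0)"
    by (intro recpred_eq0 recfun_Suc recfun_diff assms)
  moreover have "(\<lambda>xs. Suc (a xs) - b xs = 0) = (\<lambda>xs. a xs < b xs)"
    by auto
  ultimately show ?thesis by simp
qed

lemma recfun_sum:
  assumes "recfun (Suc n) (\<lambda>zs. G (hd zs) (tl zs))" "recfun n e"
  shows "recfun n (\<lambda>xs. \<Sum>j<e xs. G j xs)"
proof -
  have *: "rec_nat 0 (\<lambda>y r. r + G y xs) k = (\<Sum>j<k. G j xs)" for k xs
    by (induction k) auto
  have "recfun (Suc (Suc n)) (\<lambda>zs. zs ! 0 + G (hd (tl zs)) (tl (tl zs)))"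
    using recfun_tl[OF assms(1)] by (intro recfun_add recfun.proj) auto
  from recfun_rec[OF recfun.zero this assms(2)] show ?thesis
    by (simp add: *)
qed

lemma recfun_div2:
  assumes "recfun n a"
  shows "recfun n (\<lambda>xs. a xs div 2)"
proof (rule recfun_comp1[OF _ assms])
  \<comment> \<open>With y in front of a, \<open>?g\<close> vanishes iff a \<le> 2y + 1, so its
    least zero is a div 2.\<close>
  let ?g = "\<lambda>zs. Suc (zs ! 1) - (Suc (zs ! 0) + Suc (zs ! 0))"
  have "recfun (Suc (Suc 0)) ?g"
    by (intro recfun_diff recfun_add recfun_Suc recfun.proj) auto
  moreover have "?g (xs ! 0 # xs) = 0" for xs by simp
  ultimately have "recfun (Suc 0) (\<lambda>xs. LEAST y. ?g (y # xs) = 0)"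
    by (intro recfun.mu) blast+
  then show "recfun (Suc 0) (\<lambda>xs. xs ! 0 div 2)"
  proof (rule recfun_cong)
    fix xs :: "nat list"
    show "xs ! 0 div 2 = (LEAST y. ?g (y # xs) = 0)"
      by (rule Least_equality[symmetric]) auto
  qed
qed

section \<open>Recursive decoding of pairs and lists\<close>

lemma recfun_triangle:
  assumes "recfun n a"
  shows "recfun n (\<lambda>xs. triangle (a xs))"
proof (rule recfun_comp1[OF _ assms])
  have *: "rec_nat 0 (\<lambda>y r. r + Suc y) k = triangle k" for k by (induction k) auto
  have "recfun (Suc (Suc 1)) (\<lambda>zs. zs ! 0 + Suc (zs ! 1))"
    by (intro recfun_add recfun_Suc recfun.proj) auto
  from recfun_rec[OF recfun.zero this, of "\<lambda>xs. xs ! 0"] show "recfun (Suc 0) (\<lambda>xs. triangle (xs ! 0))"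
    using * by (simp add: recfun.proj)
qed

lemma triangle_mono: "m \<le> n \<Longrightarrow> triangle m \<le> triangle n"
  by (induction n) (auto simp: le_Suc_eq)

lemma triangle_ge: "n \<le> triangle n"
  by (induction n) auto

text \<open>\<open>prod_encode\<close> runs through the pairs along diagonals: those with sum d
  occupy the codes from \<open>triangle d\<close> up to but excluding
  \<open>triangle (Suc d)\<close>. Searching for the end of the diagonal therefore recovers the sum,
  and both components follow by subtraction.\<close>

lemma prod_encode_sum_Least: "(LEAST y. Suc (prod_encode (a, b)) - triangle (Suc y) = 0) = a + b"
proof (rule Least_equality)
  fix y assume y: "Suc (prod_encode (a, b)) - triangle (Suc y) = 0"
  show "a + b \<le> y"
  proof (rule ccontr)
    assume "\<not> a + b \<le> y"
    then have "triangle (Suc y) \<le> triangle (a + b)" by (intro triangle_mono) auto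
    then show False using y by (simp add: prod_encode_def)
  qed
qed (simp add: prod_encode_def)

lemma recfun_prod_decode_sum: "recfun (Suc 0) (\<lambda>xs. fst (prod_decode (xs ! 0)) + snd (prod_decode (xs ! 0)))"
proof -
  let ?g = "\<lambda>zs. Suc (zs ! 1) - triangle (Suc (zs ! 0))"
  have "recfun (Suc (Suc 0)) ?g"
    by (intro recfun_diff recfun_triangle recfun_Suc recfun.proj) auto
  moreover have "\<exists>y. ?g (y # xs) = 0" for xs
    by (rule exI[of _ "xs ! 0"]) (use triangle_ge[of "Suc (xs ! 0)"] in simp)
  ultimately have "recfun (Suc 0) (\<lambda>xs. LEAST y. ?g (y # xs) = 0)"
    by (intro recfun.mu) auto
  then show ?thesis
  proof (rule recfun_cong)
    fix xs :: "nat list"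
    obtain a b where ab: "prod_decode (xs ! 0) = (a, b)" by fastforce
    then have "xs ! 0 = prod_encode (a, b)" by (metis prod_decode_inverse)
    then show "fst (prod_decode (xs ! 0)) + snd (prod_decode (xs ! 0)) = (LEAST y. ?g (y # xs) = 0)"
      using prod_encode_sum_Least[of a b] by simp
  qed
qed

lemma recfun_fst_prod_decode:
  assumes "recfun n a"
  shows "recfun n (\<lambda>xs. fst (prod_decode (a xs)))"
proof (rule recfun_comp1[OF _ assms])
  have "recfun (Suc 0) (\<lambda>xs. xs ! 0 - triangle (fst (prod_decode (xs ! 0)) + snd (prod_decode (xs ! 0))))"
    by (intro recfun_diff recfun_triangle recfun_prod_decode_sum recfun.proj) auto
  then show "recfun (Suc 0) (\<lambda>xs. fst (prod_decode (xs ! 0)))"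
  proof (rule recfun_cong)
    fix xs :: "nat list"
    obtain a b where ab: "prod_decode (xs ! 0) = (a, b)" by fastforce
    then have "xs ! 0 = prod_encode (a, b)" by (metis prod_decode_inverse)
    then show "fst (prod_decode (xs ! 0)) = xs ! 0 - triangle (fst (prod_decode (xs ! 0)) + snd (prod_decode (xs ! 0)))"
      unfolding ab by (simp add: prod_encode_def)
  qed
qed

lemma recfun_snd_prod_decode:
  assumes "recfun n a"
  shows "recfun n (\<lambda>xs. snd (prod_decode (a xs)))"
proof (rule recfun_comp1[OF _ assms])
  have "recfun (Suc 0) (\<lambda>xs. (fst (prod_decode (xs ! 0)) + snd (prod_decode (xs ! 0))) - fst (prod_decode (xs ! 0)))"
    by (intro recfun_diff recfun_prod_decode_sum recfun_fst_prod_decode recfun.proj) auto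
  then show "recfun (Suc 0) (\<lambda>xs. snd (prod_decode (xs ! 0)))" by simp
qed

lemma recfun_prod_encode:
  assumes "recfun n a" "recfun n b"
  shows "recfun n (\<lambda>xs. prod_encode (a xs, b xs))"
  unfolding prod_encode_def using assms by (simp add: recfun_add recfun_triangle)

text \<open>Both are 0 on the code 0 of the empty list.\<close>

definition code_hd :: "nat \<Rightarrow> nat" where "code_hd c = fst (prod_decode (c - 1))"
definition code_tl :: "nat \<Rightarrow> nat" where "code_tl c = snd (prod_decode (c - 1))"

lemma prod_decode_0: "prod_decode 0 = (0, 0)"
  by (simp add: prod_decode_def prod_decode_aux.simps)

lemma code_hd_Cons [simp]: "code_hd (list_encode (x # xs)) = x"
  by (simp add: code_hd_def)

lemma code_tl_list_encode [simp]: "code_tl (list_encode xs) = list_encode (tl xs)"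
  by (cases xs) (auto simp: code_tl_def prod_decode_0)

lemma recfun_code_hd: "recfun n a \<Longrightarrow> recfun n (\<lambda>xs. code_hd (a xs))"
  unfolding code_hd_def by (intro recfun_fst_prod_decode recfun_pred)

lemma recfun_code_tl: "recfun n a \<Longrightarrow> recfun n (\<lambda>xs. code_tl (a xs))"
  unfolding code_tl_def by (intro recfun_snd_prod_decode recfun_pred)

text \<open>Reading past the end must give a definite value in order to be recursive; 0 is what
  \<open>code_hd\<close> returns on the empty list.\<close>

definition nth0 :: "nat list \<Rightarrow> nat \<Rightarrow> nat" where
  "nth0 xs i = (if i < length xs then xs ! i else 0)"

lemma recfun_code_drop:
  assumes "recfun n a" "recfun n b"
  shows "recfun n (\<lambda>xs. list_encode (drop (b xs) (list_decode (a xs))))"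
proof (rule recfun_comp2[OF _ assms])
  have *: "rec_nat c (\<lambda>y r. code_tl r) k = list_encode (drop k (list_decode c))" for k c
    by (induction k) (auto simp: drop_Suc tl_drop)
  have "recfun (Suc (Suc 2)) (\<lambda>zs. code_tl (zs ! 0))"
    by (intro recfun_code_tl recfun.proj) auto
  from recfun_rec[OF _ this, of "\<lambda>xs. xs ! 0" "\<lambda>xs. xs ! 1"]
  show "recfun 2 (\<lambda>xs. list_encode (drop (xs ! 1) (list_decode (xs ! 0))))"
    by (simp add: * recfun.proj)
qed

lemma recfun_code_nth0:
  assumes "recfun n a" "recfun n b"
  shows "recfun n (\<lambda>xs. nth0 (list_decode (a xs)) (b xs))"
proof -
  have "nth0 xs i = code_hd (list_encode (drop i xs))" for xs i
    by (cases "i < length xs")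
      (auto simp: nth0_def code_hd_def prod_decode_0 Cons_nth_drop_Suc[symmetric])
  then show ?thesis
    using recfun_code_hd[OF recfun_code_drop[OF assms]] by simp
qed

lemma recfun_code_length:
  assumes "recfun n a"
  shows "recfun n (\<lambda>xs. length (list_decode (a xs)))"
proof (rule recfun_comp1[OF _ assms])
  \<comment> \<open>Only the empty list has code 0, so the length is the least number of entries
    whose removal leaves code 0.\<close>
  let ?g = "\<lambda>zs. list_encode (drop (zs ! 0) (list_decode (zs ! 1)))"
  have 0: "list_encode xs = 0 \<longleftrightarrow> xs = []" for xs by (cases xs) auto
  have "recfun (Suc (Suc 0)) ?g"
    by (intro recfun_code_drop recfun.proj) auto
  then have "recfun (Suc 0) (\<lambda>xs. LEAST y. ?g (y # xs) = 0)"
    by (rule recfun.mu) (auto simp: 0)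
  moreover have "(LEAST y. ?g (y # xs) = 0) = length (list_decode (xs ! 0))" for xs
    by (rule Least_equality) (auto simp: 0)
  ultimately show "recfun (Suc 0) (\<lambda>xs. length (list_decode (xs ! 0)))" by simp
qed

lemma recfun_tabulate:
  assumes "recfun (Suc n) (\<lambda>zs. G (hd zs) (tl zs))" "recfun n e"
  shows "recfun n (\<lambda>xs. list_encode (map (\<lambda>i. G i xs) [0..<e xs]))"
proof -
  \<comment> \<open>A list code grows at its front, so the table is built from its end: round y adds
    the entry with index e - Suc y.\<close>
  define b where "b zs = Suc (prod_encode (G (e (tl (tl zs)) - Suc (zs ! 1)) (tl (tl zs)), zs ! 0))" for zs
  have e2: "recfun (Suc (Suc n)) (\<lambda>zs. e (tl (tl zs)))"
    using recfun_tl[OF recfun_tl[OF assms(2)]] by simp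
  have "recfun (Suc (Suc n)) (\<lambda>zs. e (tl (tl zs)) - Suc (zs ! 1))"
    by (intro recfun_diff recfun_Suc recfun.proj e2) auto
  from recfun_Cons_drop[OF assms(1) this, of 2]
  have "recfun (Suc (Suc n)) (\<lambda>zs. G (e (tl (tl zs)) - Suc (zs ! 1)) (tl (tl zs)))"
    by (simp add: drop_Suc numeral_2_eq_2)
  then have "recfun (Suc (Suc n)) b"
    unfolding b_def by (intro recfun_Suc recfun_prod_encode recfun.proj) auto
  from recfun_rec[OF recfun.zero this assms(2)]
  have "recfun n (\<lambda>xs. rec_nat 0 (\<lambda>y r. b (r # y # xs)) (e xs))" .
  moreover have "j \<le> e xs \<Longrightarrow> rec_nat 0 (\<lambda>y r. b (r # y # xs)) j
      = list_encode (map (\<lambda>i. G i xs) [e xs - j..<e xs])" for j xs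
  proof (induction j)
    case (Suc j)
    then have "[e xs - Suc j..<e xs] = (e xs - Suc j) # [e xs - j..<e xs]"
      by (subst upt_conv_Cons) (auto simp: Suc_diff_Suc Suc_le_eq)
    then show ?case using Suc by (simp add: b_def)
  qed auto
  from this[OF order_refl] have "rec_nat 0 (\<lambda>y r. b (r # y # xs)) (e xs)
      = list_encode (map (\<lambda>i. G i xs) [0..<e xs])" for xs by simp
  ultimately show ?thesis by simp
qed

definition code_take :: "nat \<Rightarrow> nat \<Rightarrow> nat" where
  "code_take j c = list_encode (map (\<lambda>i. nth0 (list_decode c) i) [0..<j])"

lemma recfun_code_take:
  assumes "recfun n a" "recfun n b"
  shows "recfun n (\<lambda>xs. code_take (a xs) (b xs))"
proof (rule recfun_comp2[OF _ assms])
  show "recfun 2 (\<lambda>xs. code_take (xs ! 0) (xs ! 1))"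
    unfolding code_take_def
    by (intro recfun_tabulate recfun_code_nth0 recfun_hd recfun_nth_tl recfun.proj) simp_all
qed

lemmas rec_intros = recfun_code_take recfun_code_length recfun_code_nth0 recfun_code_hd recfun_code_tl recfun_div2
  recfun_if recpred_not recpred_conj recpred_disj recpred_imp recpred_less recpred_eq
  recfun_Suc recfun_add recfun_diff recfun_const recfun_hd recfun_nth_tl recfun.proj recpred_const

section \<open>Countably many recursive functions\<close>

datatype rcode = RZ | RS | RP nat | RC rcode "rcode list" | RR rcode rcode | RM rcode

instance rcode :: countable
  by countable_datatype

primrec reval :: "rcode \<Rightarrow> nat list \<Rightarrow> nat" where
  "reval RZ = (\<lambda>_. 0)"
| "reval RS = (\<lambda>xs. Suc (hd xs))"
| "reval (RP i) = (\<lambda>xs. xs ! i)"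
| "reval (RC c cs) = (\<lambda>xs. reval c (map (\<lambda>f. f xs) (map reval cs)))"
| "reval (RR c d) = (\<lambda>ys. rec_nat (reval c (tl ys)) (\<lambda>y r. reval d (r # y # tl ys)) (hd ys))"
| "reval (RM c) = (\<lambda>xs. LEAST y. reval c (y # xs) = 0)"

text \<open>Because of \<open>ext\<close>, uncountably many functions satisfy
  \<open>recfun n\<close>. Only the values on lists of length \<open>n\<close> are determined, and
  for these countably many codes suffice.\<close>

lemma recfun_reval: "recfun n f \<Longrightarrow> \<exists>c. \<forall>xs. length xs = n \<longrightarrow> f xs = reval c xs"
proof (induction rule: recfun.induct)
  case (zero n)
  show ?case by (rule exI[of _ RZ]) simp
next
  case succ
  show ?case by (rule exI[of _ RS]) simp
next
  case (proj i n)
  show ?case by (rule exI[of _ "RP i"]) simp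
next
  case (comp m g fs n)
  then obtain c where c: "\<And>xs. length xs = m \<Longrightarrow> g xs = reval c xs" by blast
  obtain d where d: "\<And>i xs. i < m \<Longrightarrow> length xs = n \<Longrightarrow> (fs ! i) xs = reval (d i) xs"
    using comp.IH(2) by metis
  have "g (map (\<lambda>f. f xs) fs) = reval (RC c (map d [0..<m])) xs" if "length xs = n" for xs
  proof -
    have "map (\<lambda>f. f xs) fs = map (\<lambda>f. f xs) (map reval (map d [0..<m]))"
      using comp(2) d that by (intro nth_equalityI) auto
    then show ?thesis using c comp(2) by simp
  qed
  then show ?case by blast
next
  case (prim n g h)
  then obtain c d where c: "\<And>xs. length xs = n \<Longrightarrow> g xs = reval c xs"
    and d: "\<And>xs. length xs = Suc (Suc n) \<Longrightarrow> h xs = reval d xs" by metis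
  have "rec_nat (g (tl ys)) (\<lambda>y r. h (r # y # tl ys)) (hd ys) = reval (RR c d) ys"
    if "length ys = Suc n" for ys
    using that c d by simp
  then show ?case by blast
next
  case (mu n g)
  then obtain c where c: "\<And>xs. length xs = Suc n \<Longrightarrow> g xs = reval c xs" by blast
  have "(LEAST y. g (y # xs) = 0) = reval (RM c) xs" if "length xs = n" for xs
    using that c by simp
  then show ?case by blast
next
  case (ext n f f')
  then show ?case by metis
qed

lemma countable_Sigma11: "countable {A :: (nat \<Rightarrow> 'a::countable) set. Sigma11 A}"
proof (rule countable_subset)
  let ?S = "\<lambda>c. {\<sigma> :: nat \<Rightarrow> 'a. \<exists>\<beta>. \<forall>n. reval c [prefix_code (to_nat \<circ> \<sigma>) n, prefix_code \<beta> n] = 0}"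
  show "{A. Sigma11 A} \<subseteq> range ?S"
  proof
    fix A :: "(nat \<Rightarrow> 'a) set" assume "A \<in> {A. Sigma11 A}"
    then obtain R where R: "recfun 2 R" "\<And>\<sigma>. \<sigma> \<in> A \<longleftrightarrow> (\<exists>\<beta>. \<forall>n.
         R [prefix_code (to_nat \<circ> \<sigma>) n, prefix_code \<beta> n] = 0)"
      unfolding Sigma11_def by blast
    obtain c where "\<And>xs. length xs = 2 \<Longrightarrow> R xs = reval c xs"
      using recfun_reval[OF R(1)] by blast
    then have "A = ?S c" using R(2) by auto
    then show "A \<in> range ?S" by blast
  qed
qed simp

subsection \<open>Effectively Borel sets\<close>

text \<open>A finite sequence is stored as a list with its latest entry first, so that the children
  of the node \<open>s\<close> are the lists \<open>i # s\<close>.  A node with \<open>F s \<noteq> 0\<close> is a leaf, lost for the player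
  to move if \<open>F s = 1\<close> and won otherwise.\<close>

inductive game_value :: "(nat list \<Rightarrow> nat) \<Rightarrow> bool \<Rightarrow> nat list \<Rightarrow> bool" for F where
  leaf_False: "F s = 1 \<Longrightarrow> game_value F False s"
| leaf_True: "F s > 1 \<Longrightarrow> game_value F True s"
| node_True: "F s = 0 \<Longrightarrow> game_value F False (i # s) \<Longrightarrow> game_value F True s"
| node_False: "F s = 0 \<Longrightarrow> \<forall>i. game_value F True (i # s) \<Longrightarrow> game_value F False s"

text \<open>Every branch must meet leaves arbitrarily late, not just once: induction is to reach
  every list, including those that lie below a leaf.\<close>

definition game_wf :: "(nat list \<Rightarrow> nat) \<Rightarrow> bool" where
  "game_wf F \<longleftrightarrow> (\<forall>\<alpha> n. \<exists>k\<ge>n. F (rev (map \<alpha> [0..<k])) \<noteq> 0)"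

text \<open>A failure of \<open>P\<close> at a node passes to one of its children, and the node is
  then no leaf. Iterating gives a branch without leaves from the level of \<open>s\<close>
  on.\<close>

lemma game_induct [consumes 1]:
  assumes wf: "game_wf F" and step: "\<And>s. (\<And>i. F s = 0 \<Longrightarrow> P (i # s)) \<Longrightarrow> P s"
  shows "P s"
proof (rule ccontr)
  assume "\<not> P s"
  have "\<exists>t'. \<not> P t' \<and> (\<exists>i. t' = i # t) \<and> F t = 0" if "\<not> P t" for t
    using step[of t] that by blast
  then obtain c where c: "\<And>t. \<not> P t \<Longrightarrow> \<not> P (c t) \<and> (\<exists>i. c t = i # t) \<and> F t = 0"
    by metis
  define t where "t n = (c ^^ n) s" for n
  have t: "\<not> P (t n)" for n
    by (induction n) (use \<open>\<not> P s\<close> c in \<open>auto simp: t_def\<close>)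
  have tS: "\<exists>i. t (Suc n) = i # t n" and F0: "F (t n) = 0" for n
    using c[OF t[of n]] by (auto simp: t_def)
  have len: "length (t n) = length s + n" for n
  proof (induction n)
    case (Suc n)
    then show ?case using tS[of n] by auto
  qed (simp add: t_def)
  have pre: "\<exists>u. rev (t (n + m)) = rev (t n) @ u" for n m
  proof (induction m)
    case (Suc m)
    then show ?case using tS[of "n + m"] by auto
  qed auto
  \<comment> \<open>The node \<open>t (Suc k)\<close> has more than \<open>k\<close> entries, and
    later nodes only extend it, so its entry number \<open>k\<close> is final.\<close>
  define \<alpha> where "\<alpha> k = rev (t (Suc k)) ! k" for k
  have "rev (t n) = map \<alpha> [0..<length s + n]" for n
  proof (rule nth_equalityI)
    fix k assume "k < length (rev (t n))"
    then have k: "k < length s + n" by (simp add: len)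
    show "rev (t n) ! k = map \<alpha> [0..<length s + n] ! k"
    proof (cases "n \<le> Suc k")
      case True
      then obtain u where "rev (t (Suc k)) = rev (t n) @ u"
        using pre[of n "Suc k - n"] by auto
      then show ?thesis using k by (simp add: \<alpha>_def nth_append len)
    next
      case False
      then obtain u where "rev (t n) = rev (t (Suc k)) @ u"
        using pre[of "Suc k" "n - Suc k"] by auto
      then show ?thesis using k by (simp add: \<alpha>_def nth_append len)
    qed
  qed (simp add: len)
  then have "F (rev (map \<alpha> [0..<length s + n])) = 0" for n
    using F0[of n] by (metis rev_rev_ident)
  moreover obtain k where "k \<ge> length s" "F (rev (map \<alpha> [0..<k])) \<noteq> 0"
    using wf unfolding game_wf_def by blast
  ultimately show False by (metis le_add_diff_inverse)
qed

lemma game_value_exclusive: "game_value F b s \<Longrightarrow> \<not> game_value F (\<not> b) s"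
proof (induction rule: game_value.induct)
  case (leaf_False s)
  then show ?case by (auto elim: game_value.cases)
next
  case (leaf_True s)
  then show ?case by (auto elim: game_value.cases)
next
  case (node_True s i)
  then show ?case by (auto elim: game_value.cases)
next
  case (node_False s)
  then show ?case by (auto elim!: game_value.cases[of F True s])
qed

lemma game_value_total:
  assumes "game_wf F"
  shows "game_value F False s \<longleftrightarrow> \<not> game_value F True s"
proof -
  have "game_value F True s \<or> game_value F False s"
    using assms
  proof (induction s rule: game_induct)
    case (1 s)
    consider "F s = 0" | "F s = 1" | "F s > 1" by linarith
    then show ?case
      using 1 game_value.intros[of F s] by cases blast+
  qed
  then show ?thesis using game_value_exclusive by fastforce
qed

lemma list_decode_prefix_code: "list_decode (prefix_code \<beta> n) = map \<beta> [0..<n]"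
  by (simp add: prefix_code_def)

lemma prefix_code_cong: "(\<And>i. i < n \<Longrightarrow> \<alpha> i = \<beta> i) \<Longrightarrow> prefix_code \<alpha> n = prefix_code \<beta> n"
  unfolding prefix_code_def by (intro arg_cong[where f = list_encode] map_cong) auto

lemma length_prefix_code [simp]: "length (list_decode (prefix_code \<beta> n)) = n"
  by (simp add: list_decode_prefix_code)

lemma nth0_prefix_code [simp]: "nth0 (list_decode (prefix_code \<beta> n)) i = (if i < n then \<beta> i else 0)"
  by (simp add: list_decode_prefix_code nth0_def)

text \<open>A prefix whose length exceeds the code of a node is thereby long enough to evaluate the
  tree at that node.\<close>

lemma length_le_list_encode: "length s \<le> list_encode s"
proof (induction s)
  case (Cons a s)
  then show ?case using le_prod_encode_2[of "list_encode s" a] by simp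
qed simp

lemma list_encode_less_Cons: "list_encode s < list_encode (i # s)"
  using le_prod_encode_2[of "list_encode s" i] by simp

text \<open>At a node of length n only n letters of the word are read. The values are thus locally
  constant in the word, which later allows covers to be checked near a point.\<close>

definition tree_fun :: "(nat list \<Rightarrow> nat) \<Rightarrow> (nat \<Rightarrow> 'a::countable) \<Rightarrow> nat list \<Rightarrow> nat" where
  "tree_fun Fr \<sigma> s = Fr [prefix_code (to_nat \<circ> \<sigma>) (length s), list_encode s]"

text \<open>The witness \<open>\<beta>\<close> is the value function of the game, evaluated at codes of nodes, with
  \<open>0\<close> for lost and \<open>Suc i\<close> for won by moving to the \<open>i\<close>-th child.  By well-foundedness the local
  consistency conditions determine the values.\<close>

lemma Sigma11_game_value:
  fixes Fr :: "nat list \<Rightarrow> nat"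
  assumes rec: "recfun 2 Fr"
    and stable: "\<And>(\<sigma> :: nat \<Rightarrow> 'a::countable) s m. length s \<le> m \<Longrightarrow>
        Fr [prefix_code (to_nat \<circ> \<sigma>) m, list_encode s] = tree_fun Fr \<sigma> s"
    and wf: "\<And>\<sigma> :: nat \<Rightarrow> 'a. game_wf (tree_fun Fr \<sigma>)"
  shows "Sigma11 {\<sigma> :: nat \<Rightarrow> 'a. game_value (tree_fun Fr \<sigma>) b s0}"
proof -
  \<comment> \<open>Stage \<open>Suc (list_encode s)\<close> checks the node \<open>s\<close>, since
    a prefix of that length is the first to contain the entry of the witness at \<open>s\<close>.
    Stage 0 imposes nothing.\<close>
  define N where "N xs = length (list_decode (xs ! 0)) - 1" for xs
  define v where "v xs = nth0 (list_decode (xs ! 1)) (N xs)" for xs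
  define vp where "vp xs = nth0 (list_decode (xs ! 1)) (code_tl (N xs))" for xs
  define Q where "Q xs \<longleftrightarrow> length (list_decode (xs ! 0)) = 0 \<or>
     (Fr [xs ! 0, N xs] = 1 \<longrightarrow> v xs = 0) \<and> (1 < Fr [xs ! 0, N xs] \<longrightarrow> \<not> v xs = 0) \<and>
     (\<not> N xs = 0 \<and> Fr [xs ! 0, code_tl (N xs)] = 0 \<longrightarrow>
        (vp xs = 0 \<longrightarrow> \<not> v xs = 0) \<and> (vp xs = Suc (code_hd (N xs)) \<longrightarrow> v xs = 0)) \<and>
     (N xs = list_encode s0 \<longrightarrow> (b \<longrightarrow> \<not> v xs = 0) \<and> (\<not> b \<longrightarrow> v xs = 0))" for xs
  have "recpred 2 Q"
    unfolding Q_def v_def vp_def N_def by (intro rec_intros recfun_apply2[OF rec]) simp_all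
  then have R: "recfun 2 (\<lambda>xs. if Q xs then 0 else 1)" by (simp add: recpred_def)
  \<comment> \<open>A node is compared with its parent instead of its infinitely many children. The
    parent has a smaller code, so its value is already visible at the stage of the child.\<close>
  define K where "K F \<beta> s \<longleftrightarrow>
     (F s = 1 \<longrightarrow> \<beta> (list_encode s) = 0) \<and> (1 < F s \<longrightarrow> \<beta> (list_encode s) \<noteq> 0) \<and>
     (\<forall>i t. s = i # t \<and> F t = 0 \<longrightarrow> (\<beta> (list_encode t) = 0 \<longrightarrow> \<beta> (list_encode s) \<noteq> 0) \<and>
         (\<beta> (list_encode t) = Suc i \<longrightarrow> \<beta> (list_encode s) = 0)) \<and>
     (s = s0 \<longrightarrow> (\<beta> (list_encode s) \<noteq> 0 \<longleftrightarrow> b))" for F :: "nat list \<Rightarrow> nat" and \<beta> s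
  have QK: "Q [prefix_code (to_nat \<circ> \<sigma>) (Suc (list_encode s)), prefix_code \<beta> (Suc (list_encode s))]
      \<longleftrightarrow> K (tree_fun Fr \<sigma>) \<beta> s" for \<sigma> :: "nat \<Rightarrow> 'a" and \<beta> s
  proof -
    let ?xs = "[prefix_code (to_nat \<circ> \<sigma>) (Suc (list_encode s)), prefix_code \<beta> (Suc (list_encode s))]"
    have N: "N ?xs = list_encode s" and v: "v ?xs = \<beta> (list_encode s)"
      by (simp_all add: N_def v_def)
    have F: "Fr [?xs ! 0, N ?xs] = tree_fun Fr \<sigma> s"
      using stable[of s "Suc (list_encode s)" \<sigma>] length_le_list_encode[of s] N by simp
    show ?thesis
    proof (cases s)
      case Nil
      then show ?thesis
        using N v F list_encode_eq[of "[]" s0] by (auto simp: Q_def K_def)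
    next
      case (Cons i t)
      have less: "list_encode t < list_encode s"
        using list_encode_less_Cons Cons by blast
      have tl: "code_tl (list_encode s) = list_encode t" and hd: "code_hd (list_encode s) = i"
        by (simp_all only: Cons code_tl_list_encode code_hd_Cons list.sel)
      have vp: "vp ?xs = \<beta> (list_encode t)"
        using less unfolding vp_def N tl by simp
      have Fp: "Fr [?xs ! 0, code_tl (N ?xs)] = tree_fun Fr \<sigma> t"
        using stable[of t "Suc (list_encode s)" \<sigma>] length_le_list_encode[of t] less
        unfolding N tl by simp
      have "Q ?xs \<longleftrightarrow> (tree_fun Fr \<sigma> s = 1 \<longrightarrow> \<beta> (list_encode s) = 0) \<and>
         (1 < tree_fun Fr \<sigma> s \<longrightarrow> \<not> \<beta> (list_encode s) = 0) \<and>
         (tree_fun Fr \<sigma> t = 0 \<longrightarrow> (\<beta> (list_encode t) = 0 \<longrightarrow> \<not> \<beta> (list_encode s) = 0) \<and>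
           (\<beta> (list_encode t) = Suc i \<longrightarrow> \<beta> (list_encode s) = 0)) \<and>
         (s = s0 \<longrightarrow> (b \<longrightarrow> \<not> \<beta> (list_encode s) = 0) \<and> (\<not> b \<longrightarrow> \<beta> (list_encode s) = 0))"
        unfolding Q_def F Fp vp v unfolding N hd
        using less by (simp add: list_encode_eq)
      also have "\<dots> \<longleftrightarrow> K (tree_fun Fr \<sigma>) \<beta> s"
        unfolding K_def Cons by auto
      finally show ?thesis .
    qed
  qed
  have "Q [prefix_code \<alpha> 0, prefix_code \<beta> 0]" for \<alpha> \<beta>
    by (simp add: Q_def)
  then have all: "(\<forall>n. Q [prefix_code (to_nat \<circ> \<sigma>) n, prefix_code \<beta> n]) \<longleftrightarrow> (\<forall>s. K (tree_fun Fr \<sigma>) \<beta> s)"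
    for \<sigma> :: "nat \<Rightarrow> 'a" and \<beta>
    using QK by (metis list_decode_inverse not0_implies_Suc)
  have "game_value (tree_fun Fr \<sigma>) b s0 \<longleftrightarrow> (\<exists>\<beta>. \<forall>s. K (tree_fun Fr \<sigma>) \<beta> s)" for \<sigma> :: "nat \<Rightarrow> 'a"
  proof -
    let ?F = "tree_fun Fr \<sigma>"
    note tot = game_value_total[OF wf[of \<sigma>]]
    show ?thesis
    proof
      assume b: "game_value ?F b s0"
      \<comment> \<open>At a won leaf there is no move to choose, but the value still has to be
        positive; hence the implication under \<open>SOME\<close>.\<close>
      define \<gamma> where "\<gamma> s = (if game_value ?F True s then Suc (SOME i. ?F s = 0 \<longrightarrow> game_value ?F False (i # s)) else 0)" for s
      have some: "game_value ?F False (i # s)" if "\<gamma> s = Suc i" "?F s = 0" for i s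
      proof -
        have "game_value ?F True s" using that by (auto simp: \<gamma>_def split: if_splits)
        then have "\<exists>i. ?F s = 0 \<longrightarrow> game_value ?F False (i # s)"
          by (cases rule: game_value.cases) auto
        from someI_ex[OF this] show ?thesis using that by (auto simp: \<gamma>_def split: if_splits)
      qed
      have \<gamma>0: "\<gamma> s = 0 \<longleftrightarrow> game_value ?F False s" for s
        using tot by (simp add: \<gamma>_def)
      have "K ?F (\<gamma> \<circ> list_decode) s" for s
        unfolding K_def
      proof (intro conjI allI impI; (elim conjE)?)
        show "(\<gamma> \<circ> list_decode) (list_encode s) = 0" if "?F s = 1"
          using that by (simp add: \<gamma>0 game_value.leaf_False)
        show "(\<gamma> \<circ> list_decode) (list_encode s) \<noteq> 0" if "1 < ?F s"
          using that by (simp add: \<gamma>0 tot game_value.leaf_True)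
        show "(\<gamma> \<circ> list_decode) (list_encode s) \<noteq> 0"
          if "(\<gamma> \<circ> list_decode) (list_encode t) = 0" "s = i # t" "?F t = 0" for i t
          using that game_value.node_True[of ?F t i] by (auto simp: \<gamma>0 tot)
        show "(\<gamma> \<circ> list_decode) (list_encode s) = 0"
          if "(\<gamma> \<circ> list_decode) (list_encode t) = Suc i" "s = i # t" "?F t = 0" for i t
          using that some by (auto simp: \<gamma>0)
        show "((\<gamma> \<circ> list_decode) (list_encode s) \<noteq> 0) = b" if "s = s0"
          using that b tot by (cases b) (auto simp: \<gamma>0)
      qed
      then show "\<exists>\<beta>. \<forall>s. K ?F \<beta> s" by blast
    next
      assume "\<exists>\<beta>. \<forall>s. K ?F \<beta> s"
      then obtain \<beta> where K: "\<And>s. K ?F \<beta> s" by blast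
      have "game_value ?F (\<beta> (list_encode s) \<noteq> 0) s" for s
        using wf[of \<sigma>]
      proof (induction s rule: game_induct)
        case (1 s)
        consider "?F s = 0" | "?F s = 1" | "?F s > 1" by linarith
        then show ?case
        proof cases
          case 1
          show ?thesis
          proof (cases "\<beta> (list_encode s)")
            case 0
            have "\<beta> (list_encode (i # s)) \<noteq> 0" for i
              using K[of "i # s"] 0 \<open>?F s = 0\<close> unfolding K_def by blast
            then have "game_value ?F True (i # s)" for i
              using "1.IH"[OF \<open>?F s = 0\<close>, of i] by simp
            then show ?thesis
              using 0 \<open>?F s = 0\<close> by (simp add: game_value.node_False)
          next
            case (Suc i)
            have "\<beta> (list_encode (i # s)) = 0"
              using K[of "i # s"] Suc \<open>?F s = 0\<close> unfolding K_def by blast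
            then have "game_value ?F False (i # s)"
              using "1.IH"[OF \<open>?F s = 0\<close>, of i] by simp
            then show ?thesis
              using Suc game_value.node_True[of ?F s, OF \<open>?F s = 0\<close>] by simp
          qed
        qed (use K[of s] game_value.intros(1,2)[of ?F s] in \<open>auto simp: K_def\<close>)
      qed
      from this[of s0] K[of s0] show "game_value ?F b s0"
        by (simp add: K_def)
    qed
  qed
  then show ?thesis
    unfolding Sigma11_def using R all by (intro exI[of _ "\<lambda>xs. if Q xs then 0 else 1"]) simp
qed

section \<open>A recursive game for each effectively Borel set\<close>

lemma code_take_prefix_code: "j \<le> n \<Longrightarrow> code_take j (prefix_code \<alpha> n) = prefix_code \<alpha> j"
  unfolding code_take_def nth0_prefix_code unfolding prefix_code_def
  by (intro arg_cong[where f = list_encode] map_cong) auto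

text \<open>Summing \<open>R\<close> over all shorter prefixes makes failure permanent: the sum
  vanishes iff every earlier test succeeds. A wrong witness can then be caught at any later
  stage.\<close>

lemma Sigma11_cumulative:
  assumes "Sigma11 (A :: (nat \<Rightarrow> 'a::countable) set)"
  obtains R where "recfun 2 R"
    "\<And>\<sigma>. \<sigma> \<in> A \<longleftrightarrow> (\<exists>\<beta>. \<forall>n. R [prefix_code (to_nat \<circ> \<sigma>) n, prefix_code \<beta> n] = 0)"
    "\<And>\<alpha> \<beta> m n. m \<le> n \<Longrightarrow> R [prefix_code \<alpha> n, prefix_code \<beta> n] = 0 \<Longrightarrow> R [prefix_code \<alpha> m, prefix_code \<beta> m] = 0"
proof -
  obtain R where R: "recfun 2 R"
    "\<And>\<sigma>. \<sigma> \<in> A \<longleftrightarrow> (\<exists>\<beta>. \<forall>n. R [prefix_code (to_nat \<circ> \<sigma>) n, prefix_code \<beta> n] = 0)"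
    using assms unfolding Sigma11_def by blast
  define R' where "R' xs = (\<Sum>j<Suc (length (list_decode (xs ! 0))). R [code_take j (xs ! 0), code_take j (xs ! 1)])" for xs
  have "recfun (Suc 2) (\<lambda>zs. R [code_take (hd zs) (tl zs ! 0), code_take (hd zs) (tl zs ! 1)])"
    by (intro recfun_apply2[OF R(1)] rec_intros) simp_all
  then have "recfun 2 R'"
    unfolding R'_def by (intro recfun_sum rec_intros) simp_all
  have R': "R' [prefix_code \<alpha> n, prefix_code \<beta> n] = 0 \<longleftrightarrow> (\<forall>j\<le>n. R [prefix_code \<alpha> j, prefix_code \<beta> j] = 0)"
    for \<alpha> \<beta> n
  proof -
    have "R' [prefix_code \<alpha> n, prefix_code \<beta> n] = (\<Sum>j<Suc n. R [code_take j (prefix_code \<alpha> n), code_take j (prefix_code \<beta> n)])"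
      by (simp add: R'_def)
    also have "\<dots> = (\<Sum>j<Suc n. R [prefix_code \<alpha> j, prefix_code \<beta> j])"
      by (intro sum.cong) (auto simp: code_take_prefix_code)
    finally show ?thesis
      by (simp only: sum_eq_0_iff finite_lessThan Ball_def lessThan_iff less_Suc_eq_le)
  qed
  show thesis
  proof (rule that[OF \<open>recfun 2 R'\<close>])
    show "\<sigma> \<in> A \<longleftrightarrow> (\<exists>\<beta>. \<forall>n. R' [prefix_code (to_nat \<circ> \<sigma>) n, prefix_code \<beta> n] = 0)" for \<sigma>
      unfolding R(2) R' by (metis order_refl)
  qed (unfold R', meson order_trans)
qed

text \<open>Lusin separation, one point at a time: two players alternately extend alleged witnesses
  for \<open>\<sigma> \<in> A\<close> and for \<open>\<sigma> \<notin> A\<close>, and the first one caught at a wrong witness loses.  As at most one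
  of the witnesses exists, every play is finite.\<close>

lemma Delta11_game:
  assumes "Delta11 (A :: (nat \<Rightarrow> 'a::countable) set)"
  obtains Fr where "recfun 2 Fr"
    "\<And>(\<sigma> :: nat \<Rightarrow> 'a) s m. length s \<le> m \<Longrightarrow>
        Fr [prefix_code (to_nat \<circ> \<sigma>) m, list_encode s] = tree_fun Fr \<sigma> s"
    "\<And>\<sigma> :: nat \<Rightarrow> 'a. game_wf (tree_fun Fr \<sigma>)"
    "\<And>\<sigma>. \<sigma> \<in> A \<longleftrightarrow> game_value (tree_fun Fr \<sigma>) True []"
proof -
  have "Sigma11 A" "Sigma11 (- A)" using assms by (auto simp: Delta11_def Pi11_def)
  obtain R where R: "recfun 2 R"
    "\<And>\<sigma>. \<sigma> \<in> A \<longleftrightarrow> (\<exists>\<beta>. \<forall>n. R [prefix_code (to_nat \<circ> \<sigma>) n, prefix_code \<beta> n] = 0)"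
    "\<And>\<alpha> \<beta> m n. m \<le> n \<Longrightarrow> R [prefix_code \<alpha> n, prefix_code \<beta> n] = 0 \<Longrightarrow> R [prefix_code \<alpha> m, prefix_code \<beta> m] = 0"
    using Sigma11_cumulative[OF \<open>Sigma11 A\<close>] by metis
  obtain R' where R': "recfun 2 R'"
    "\<And>\<sigma>. \<sigma> \<in> - A \<longleftrightarrow> (\<exists>\<beta>. \<forall>n. R' [prefix_code (to_nat \<circ> \<sigma>) n, prefix_code \<beta> n] = 0)"
    "\<And>\<alpha> \<beta> m n. m \<le> n \<Longrightarrow> R' [prefix_code \<alpha> n, prefix_code \<beta> n] = 0 \<Longrightarrow> R' [prefix_code \<alpha> m, prefix_code \<beta> m] = 0"
    using Sigma11_cumulative[OF \<open>Sigma11 (- A)\<close>] by metis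
  define l where "l c = length (list_decode c)" for c
  \<comment> \<open>Nodes list the latest move first, so index \<open>l c - Suc j\<close> reads move
    number j. \<open>U\<close> collects the even moves, made for membership in \<open>A\<close>, and
    \<open>V\<close> the odd ones, made against it.\<close>
  define U where "U c = list_encode (map (\<lambda>i. nth0 (list_decode c) (l c - Suc (i + i))) [0..<l c div 2])" for c
  define V where "V c = list_encode (map (\<lambda>i. nth0 (list_decode c) (l c - Suc (Suc (i + i)))) [0..<l c div 2])" for c
  \<comment> \<open>Tests take place at even lengths, when both players have made equally many moves
    and the one claiming membership is to move. A failure of that player's witness is a leaf lost
    for the mover, value 1; a failure of only the opponent's is a leaf won, value 2.\<close>
  define Fr where "Fr xs =
     (if l (xs ! 1) = l (xs ! 1) div 2 + l (xs ! 1) div 2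
      then if R [code_take (l (xs ! 1) div 2) (xs ! 0), U (xs ! 1)] = 0
           then if R' [code_take (l (xs ! 1) div 2) (xs ! 0), V (xs ! 1)] = 0 then 0 else 2
           else 1
      else (0::nat))" for xs
  have UV: "recfun 2 (\<lambda>xs. U (xs ! 1))" "recfun 2 (\<lambda>xs. V (xs ! 1))"
    unfolding U_def V_def l_def by (intro recfun_tabulate rec_intros; simp)+
  have Fr: "recfun 2 Fr"
    unfolding Fr_def l_def
    by (intro recfun_apply2[OF R(1)] recfun_apply2[OF R'(1)] UV rec_intros) simp_all
  have l: "l (list_encode s) = length s" for s by (simp add: l_def)
  have U: "U (list_encode s) = prefix_code (\<lambda>i. rev s ! (2 * i)) k" if "length s = 2 * k" for s k
    unfolding U_def l prefix_code_def
    by (intro arg_cong[where f = list_encode] map_cong)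
      (use that in \<open>auto simp: nth0_def rev_nth mult_2\<close>)
  have V: "V (list_encode s) = prefix_code (\<lambda>i. rev s ! Suc (2 * i)) k" if "length s = 2 * k" for s k
    unfolding V_def l prefix_code_def
    by (intro arg_cong[where f = list_encode] map_cong)
      (use that in \<open>auto simp: nth0_def rev_nth mult_2\<close>)
  have even: "Fr [prefix_code \<alpha> m, list_encode s] =
      (if R [prefix_code \<alpha> k, prefix_code (\<lambda>i. rev s ! (2 * i)) k] = 0
       then if R' [prefix_code \<alpha> k, prefix_code (\<lambda>i. rev s ! Suc (2 * i)) k] = 0 then 0 else 2
       else 1)" if "length s = 2 * k" "length s \<le> m" for \<alpha> m s k
    using that unfolding Fr_def by (simp add: l U[OF that(1)] V[OF that(1)] code_take_prefix_code mult_2)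
  have odd: "Fr [prefix_code \<alpha> m, list_encode s] = 0" if "odd (length s)" for \<alpha> m s
  proof -
    have "length s \<noteq> length s div 2 + length s div 2" using that by presburger
    then show ?thesis unfolding Fr_def by (simp add: l)
  qed
  have stable: "Fr [prefix_code (to_nat \<circ> \<sigma>) m, list_encode s] = tree_fun Fr \<sigma> s"
    if "length s \<le> m" for \<sigma> :: "nat \<Rightarrow> 'a" and s m
  proof (cases "even (length s)")
    case True
    then obtain k where "length s = 2 * k" by blast
    then show ?thesis using that by (simp add: tree_fun_def even)
  qed (simp add: tree_fun_def odd)
  have wf: "game_wf (tree_fun Fr \<sigma>)" for \<sigma> :: "nat \<Rightarrow> 'a"
    unfolding game_wf_def
  proof (intro allI)
    fix \<alpha> :: "nat \<Rightarrow> nat" and n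
    let ?\<beta> = "\<lambda>i. \<alpha> (2 * i)" and ?\<gamma> = "\<lambda>i. \<alpha> (Suc (2 * i))" and ?\<sigma> = "to_nat \<circ> \<sigma>"
    have "(\<exists>k. R [prefix_code ?\<sigma> k, prefix_code ?\<beta> k] \<noteq> 0) \<or> (\<exists>k. R' [prefix_code ?\<sigma> k, prefix_code ?\<gamma> k] \<noteq> 0)"
      using R(2)[of \<sigma>] R'(2)[of \<sigma>] by blast
    then obtain k0 where "R [prefix_code ?\<sigma> k0, prefix_code ?\<beta> k0] \<noteq> 0 \<or> R' [prefix_code ?\<sigma> k0, prefix_code ?\<gamma> k0] \<noteq> 0"
      by blast
    \<comment> \<open>Failures persist, which shifts the stage of the failure past \<open>n\<close>
      as \<open>game_wf\<close> demands.\<close>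
    then have k: "R [prefix_code ?\<sigma> (k0 + n), prefix_code ?\<beta> (k0 + n)] \<noteq> 0 \<or>
        R' [prefix_code ?\<sigma> (k0 + n), prefix_code ?\<gamma> (k0 + n)] \<noteq> 0"
      using R(3)[OF le_add1[of k0 n], of ?\<sigma> ?\<beta>] R'(3)[OF le_add1[of k0 n], of ?\<sigma> ?\<gamma>] by metis
    let ?s = "rev (map \<alpha> [0..<2 * (k0 + n)])"
    have eqs: "prefix_code (\<lambda>i. rev ?s ! (2 * i)) (k0 + n) = prefix_code ?\<beta> (k0 + n)"
      "prefix_code (\<lambda>i. rev ?s ! Suc (2 * i)) (k0 + n) = prefix_code ?\<gamma> (k0 + n)"
      by (intro prefix_code_cong; simp)+
    have len: "length ?s = 2 * (k0 + n)" by simp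
    have "tree_fun Fr \<sigma> ?s \<noteq> 0"
      unfolding tree_fun_def even[OF len order_refl] eqs using k by auto
    then show "\<exists>k\<ge>n. tree_fun Fr \<sigma> (rev (map \<alpha> [0..<k])) \<noteq> 0"
      by (intro exI[of _ "2 * (k0 + n)"]) simp
  qed
  have tree_even: "tree_fun Fr \<sigma> s =
      (if R [prefix_code (to_nat \<circ> \<sigma>) k, prefix_code (\<lambda>i. rev s ! (2 * i)) k] = 0
       then if R' [prefix_code (to_nat \<circ> \<sigma>) k, prefix_code (\<lambda>i. rev s ! Suc (2 * i)) k] = 0 then 0 else 2
       else 1)" if "length s = 2 * k" for \<sigma> :: "nat \<Rightarrow> 'a" and s k
    unfolding tree_fun_def by (rule even[OF that order_refl])
  have tree_odd: "tree_fun Fr \<sigma> s = 0" if "odd (length s)" for \<sigma> :: "nat \<Rightarrow> 'a" and s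
    using odd[OF that] by (simp add: tree_fun_def)
  have mem: "game_value (tree_fun Fr \<sigma>) True []" if "\<sigma> \<in> A" for \<sigma>
  proof -
    obtain \<beta> where \<beta>: "\<And>n. R [prefix_code (to_nat \<circ> \<sigma>) n, prefix_code \<beta> n] = 0"
      using R(2) \<open>\<sigma> \<in> A\<close> by blast
    \<comment> \<open>Copying a correct witness is a winning strategy. Along positions that follow
      it, the player claiming membership wins, and this player is to move exactly at even
      lengths.\<close>
    have "(\<forall>i. 2 * i < length s \<longrightarrow> rev s ! (2 * i) = \<beta> i) \<longrightarrow>
        game_value (tree_fun Fr \<sigma>) (even (length s)) s" for s
      using wf[of \<sigma>]
    proof (induction s rule: game_induct)
      case (1 s)
      show ?case
      proof
        assume s: "\<forall>i. 2 * i < length s \<longrightarrow> rev s ! (2 * i) = \<beta> i"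
        show "game_value (tree_fun Fr \<sigma>) (even (length s)) s"
        proof (cases "even (length s)")
          case True
          then obtain k where k: "length s = 2 * k" by blast
          have "prefix_code (\<lambda>i. rev s ! (2 * i)) k = prefix_code \<beta> k"
            using s k by (intro prefix_code_cong) simp
          then have F: "tree_fun Fr \<sigma> s = 0 \<or> tree_fun Fr \<sigma> s = 2"
            using \<beta> tree_even[OF k] by simp
          show ?thesis
          proof (cases "tree_fun Fr \<sigma> s = 0")
            case True
            have "\<forall>i. 2 * i < length (\<beta> k # s) \<longrightarrow> rev (\<beta> k # s) ! (2 * i) = \<beta> i"
              using s k by (auto simp: nth_append less_Suc_eq)
            then have "game_value (tree_fun Fr \<sigma>) False (\<beta> k # s)"
              using "1.IH"[OF True, of "\<beta> k"] k by simp
            then show ?thesis using game_value.node_True[of "tree_fun Fr \<sigma>" s, OF True] k by simp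
          next
            case False
            then show ?thesis using F k by (simp add: game_value.leaf_True)
          qed
        next
          case False
          then have "2 * i \<noteq> length s" for i by (metis dvd_triv_left)
          then have "\<forall>i. 2 * i < length (j # s) \<longrightarrow> rev (j # s) ! (2 * i) = \<beta> i" for j
            using s by (auto simp: nth_append less_Suc_eq)
          then have "game_value (tree_fun Fr \<sigma>) True (j # s)" for j
            using "1.IH"[OF tree_odd[OF False], of j] False by simp
          then show ?thesis
            using game_value.node_False[of "tree_fun Fr \<sigma>" s, OF tree_odd[OF False]] False by simp
        qed
      qed
    qed
    from this[of "[]"] show ?thesis by simp
  qed
  have nonmem: "game_value (tree_fun Fr \<sigma>) False []" if "\<sigma> \<notin> A" for \<sigma>
  proof -
    obtain \<gamma> where \<gamma>: "\<And>n. R' [prefix_code (to_nat \<circ> \<sigma>) n, prefix_code \<gamma> n] = 0"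
      using R'(2) \<open>\<sigma> \<notin> A\<close> by blast
    \<comment> \<open>The mirror image: copying \<gamma> at the odd moves wins for the opponent, who
      is to move exactly at odd lengths.\<close>
    have "(\<forall>i. Suc (2 * i) < length s \<longrightarrow> rev s ! Suc (2 * i) = \<gamma> i) \<longrightarrow>
        game_value (tree_fun Fr \<sigma>) (odd (length s)) s" for s
      using wf[of \<sigma>]
    proof (induction s rule: game_induct)
      case (1 s)
      show ?case
      proof
        assume s: "\<forall>i. Suc (2 * i) < length s \<longrightarrow> rev s ! Suc (2 * i) = \<gamma> i"
        show "game_value (tree_fun Fr \<sigma>) (odd (length s)) s"
        proof (cases "even (length s)")
          case True
          then obtain k where k: "length s = 2 * k" by blast
          have "prefix_code (\<lambda>i. rev s ! Suc (2 * i)) k = prefix_code \<gamma> k"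
            using s k by (intro prefix_code_cong) simp
          then have F: "tree_fun Fr \<sigma> s = 0 \<or> tree_fun Fr \<sigma> s = 1"
            using \<gamma> tree_even[OF k] by simp
          show ?thesis
          proof (cases "tree_fun Fr \<sigma> s = 0")
            case 0: True
            have "\<forall>i. Suc (2 * i) < length (j # s) \<longrightarrow> rev (j # s) ! Suc (2 * i) = \<gamma> i" for j
              using s k by (auto simp: nth_append)
            then have "game_value (tree_fun Fr \<sigma>) True (j # s)" for j
              using "1.IH"[OF 0, of j] k by simp
            then show ?thesis using game_value.node_False[of "tree_fun Fr \<sigma>" s, OF 0] k by simp
          next
            case False
            then show ?thesis using F k by (simp add: game_value.leaf_False)
          qed
        next
          case False
          then obtain k where k: "length s = Suc (2 * k)" using oddE by fastforce
          have "\<forall>i. Suc (2 * i) < length (\<gamma> k # s) \<longrightarrow> rev (\<gamma> k # s) ! Suc (2 * i) = \<gamma> i"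
            using s k by (auto simp: nth_append less_Suc_eq)
          then have "game_value (tree_fun Fr \<sigma>) False (\<gamma> k # s)"
            using "1.IH"[OF tree_odd[OF False], of "\<gamma> k"] k by simp
          then show ?thesis
            using game_value.node_True[of "tree_fun Fr \<sigma>" s, OF tree_odd[OF False]] k by simp
        qed
      qed
    qed
    from this[of "[]"] show ?thesis by simp
  qed
  have "\<sigma> \<in> A \<longleftrightarrow> game_value (tree_fun Fr \<sigma>) True []" for \<sigma>
    using mem nonmem game_value_total[OF wf[of \<sigma>]] by blast
  with Fr stable wf show thesis by (rule that)
qed

lemma Delta11_cyl: "Delta11 (cyl n (a :: 'a::countable))"
proof -
  \<comment> \<open>The flag \<open>c\<close> treats the cylinder and its complement together;
    prefixes too short to show letter \<open>n\<close> pass.\<close>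
  define P where "P c xs \<longleftrightarrow> length (list_decode (xs ! 0)) < Suc n \<or>
     (if c then nth0 (list_decode (xs ! 0)) n = to_nat a else \<not> nth0 (list_decode (xs ! 0)) n = to_nat a)" for c xs
  have "recpred 2 (P c)" for c
    unfolding P_def by (cases c; simp; intro rec_intros; simp)
  then have rec: "recfun 2 (\<lambda>xs. if P c xs then 0 else 1)" for c
    by (simp add: recpred_def)
  have "Sigma11 {\<sigma>. (\<sigma> n = a) = c}" for c
    unfolding Sigma11_def
  proof (intro exI conjI allI)
    show "recfun 2 (\<lambda>xs. if P c xs then 0 else 1)" by (rule rec)
    fix \<sigma> :: "nat \<Rightarrow> 'a"
    have "(\<forall>m. P c [prefix_code (to_nat \<circ> \<sigma>) m, prefix_code \<beta> m]) \<longleftrightarrow> (\<sigma> n = a) = c" for \<beta>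
    proof
      assume "\<forall>m. P c [prefix_code (to_nat \<circ> \<sigma>) m, prefix_code \<beta> m]"
      from spec[OF this, of "Suc n"] show "(\<sigma> n = a) = c" by (auto simp: P_def split: if_splits)
    qed (auto simp: P_def)
    then show "\<sigma> \<in> {\<sigma>. (\<sigma> n = a) = c} \<longleftrightarrow> (\<exists>\<beta>. \<forall>m.
        (if P c [prefix_code (to_nat \<circ> \<sigma>) m, prefix_code \<beta> m] then 0 else 1) = (0::nat))"
      by simp
  qed
  from this[of True] this[of False] show ?thesis
    by (simp add: Delta11_def Pi11_def cyl_def Compl_eq)
qed

lemma Delta11_Compl: "Delta11 A \<Longrightarrow> Delta11 (- A)"
  by (simp add: Delta11_def Pi11_def)

lemma Polish_Delta11:
  "Polish_space (topology_generated_by {A :: (nat \<Rightarrow> 'a::countable) set. Delta11 A}) \<and>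
   zero_dimensional (topology_generated_by {A :: (nat \<Rightarrow> 'a) set. Delta11 A})"
proof (rule Polish_words)
  let ?D = "{A :: (nat \<Rightarrow> 'a) set. Delta11 A}"
  show "countable ?D"
    by (rule countable_subset[OF _ countable_Sigma11]) (auto simp: Delta11_def)
  fix A assume "A \<in> ?D"
  then have "Delta11 A" by simp
  then obtain Fr where Fr: "recfun 2 Fr"
    "\<And>(\<sigma> :: nat \<Rightarrow> 'a) s m. length s \<le> m \<Longrightarrow>
        Fr [prefix_code (to_nat \<circ> \<sigma>) m, list_encode s] = tree_fun Fr \<sigma> s"
    "\<And>\<sigma> :: nat \<Rightarrow> 'a. game_wf (tree_fun Fr \<sigma>)"
    "\<And>\<sigma>. \<sigma> \<in> A \<longleftrightarrow> game_value (tree_fun Fr \<sigma>) True []"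
    using Delta11_game[of A] by metis
  define C where "C b s = {\<sigma> :: nat \<Rightarrow> 'a. game_value (tree_fun Fr \<sigma>) b s}" for b s
  have compl: "- C b s = C (\<not> b) s" for b s
    using game_value_total[OF Fr(3)] by (cases b) (auto simp: C_def)
  have S: "Sigma11 (C b s)" for b s
    unfolding C_def by (rule Sigma11_game_value[OF Fr(1-3)])
  then have CD: "C b s \<in> ?D" for b s
    using compl[of b s] by (simp add: Delta11_def Pi11_def)
  \<comment> \<open>Only a won inner node calls for an infinite cover, by its lost children. Near
    \<open>x\<close>, a lost inner node is covered by \<open>C True (i # s)\<close> for each single
    \<open>i\<close>, and at a leaf the empty cover already decides.\<close>
  define \<K> where "\<K> = range (\<lambda>s. range (\<lambda>i. C False (i # s)))"
  show "\<exists>\<K>. countable \<K> \<and> \<K> \<subseteq> Pow ?D \<and> (\<forall>Y x. adequate ?D \<K> Y x \<longrightarrow> A \<in> Y \<longrightarrow> x \<in> A)"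
  proof (intro exI conjI allI impI)
    show "countable \<K>" by (simp add: \<K>_def)
    show "\<K> \<subseteq> Pow ?D" using CD by (auto simp: \<K>_def)
    fix Y x assume ad: "adequate ?D \<K> Y x" and "A \<in> Y"
    let ?F = "tree_fun Fr x"
    have "\<forall>b. C b s \<in> Y \<longrightarrow> x \<in> C b s" for s
      using Fr(3)[of x]
    proof (induction s rule: game_induct)
      case (1 s)
      have local: "tree_fun Fr \<sigma> s = ?F s" if "\<forall>m<length s. \<sigma> m = x m" for \<sigma> :: "nat \<Rightarrow> 'a"
        unfolding tree_fun_def using that prefix_code_cong[of "length s" "to_nat \<circ> \<sigma>" "to_nat \<circ> x"] by simp
      show ?case
      proof (intro allI impI)
        fix b assume b: "C b s \<in> Y"
        have cover: "\<exists>G\<in>E \<union> F. G \<in> Y"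
          if "E \<in> insert {} \<K>" "finite F" "F \<subseteq> ?D"
            "\<And>\<sigma>. \<sigma> \<in> C b s \<Longrightarrow> tree_fun Fr \<sigma> s = ?F s \<Longrightarrow> \<sigma> \<in> \<Union>E \<union> \<Union>F" for E F
        proof (rule adequate_local_cover[OF ad b that(1-3), where k = "length s"])
          show "\<sigma> \<in> \<Union>E \<union> \<Union>F" if "\<sigma> \<in> C b s" "\<forall>m<length s. \<sigma> m = x m" for \<sigma>
            using \<open>\<And>\<sigma>. \<sigma> \<in> C b s \<Longrightarrow> tree_fun Fr \<sigma> s = ?F s \<Longrightarrow> \<sigma> \<in> \<Union>E \<union> \<Union>F\<close> that local by blast
        qed (auto simp: Delta11_cyl Delta11_Compl)
        show "x \<in> C b s"
        proof (cases "?F s = 0")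
          case 0: True
          show ?thesis
          proof (cases b)
            case True
            have "\<exists>G\<in>range (\<lambda>i. C False (i # s)) \<union> {}. G \<in> Y"
            proof (rule cover)
              fix \<sigma> assume "\<sigma> \<in> C b s" "tree_fun Fr \<sigma> s = ?F s"
              then have "game_value (tree_fun Fr \<sigma>) True s" "tree_fun Fr \<sigma> s = 0"
                using 0 True by (auto simp: C_def)
              then show "\<sigma> \<in> \<Union>(range (\<lambda>i. C False (i # s))) \<union> \<Union>{}"
                by (cases rule: game_value.cases) (auto simp: C_def)
            qed (auto simp: \<K>_def)
            then obtain i where "C False (i # s) \<in> Y" by auto
            then have "x \<in> C False (i # s)" using "1.IH"[OF 0] by blast
            then show ?thesis using game_value.node_True[of ?F s, OF 0] True by (auto simp: C_def)
          next
            case False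
            have "C True (i # s) \<in> Y" for i
            proof -
              have "\<exists>G\<in>{} \<union> {C True (i # s)}. G \<in> Y"
              proof (rule cover)
                fix \<sigma> assume "\<sigma> \<in> C b s" "tree_fun Fr \<sigma> s = ?F s"
                then have "game_value (tree_fun Fr \<sigma>) False s" "tree_fun Fr \<sigma> s = 0"
                  using 0 False by (auto simp: C_def)
                then show "\<sigma> \<in> \<Union>{} \<union> \<Union>{C True (i # s)}"
                  by (cases rule: game_value.cases) (auto simp: C_def)
              qed (use CD in auto)
              then show ?thesis by simp
            qed
            then have "x \<in> C True (i # s)" for i using "1.IH"[OF 0] by blast
            then show ?thesis using game_value.node_False[of ?F s, OF 0] False by (auto simp: C_def)
          qed
        next
          case False
          \<comment> \<open>Otherwise the empty family would cover \<open>C b s\<close> near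
            \<open>x\<close>, and \<open>Y\<close> would have to contain a member of it. Any such
            word carries the same leaf label as \<open>x\<close>, and a leaf label determines the
            value.\<close>
          have "\<exists>\<sigma>. \<sigma> \<in> C b s \<and> tree_fun Fr \<sigma> s = ?F s"
            using cover[of "{}" "{}"] by blast
          then obtain \<sigma> :: "nat \<Rightarrow> 'a" where "game_value (tree_fun Fr \<sigma>) b s" "tree_fun Fr \<sigma> s = ?F s"
            by (auto simp: C_def)
          then have "game_value ?F b s"
            using False
            by (cases rule: game_value.cases) (auto intro: game_value.leaf_True game_value.leaf_False)
          then show ?thesis by (simp add: C_def)
        qed
      qed
    qed
    moreover have "A = C True []" using Fr(4) by (auto simp: C_def)
    ultimately show "x \<in> A" using \<open>A \<in> Y\<close> by blast
  qed
qed (auto simp: Delta11_cyl Delta11_Compl)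

subsection \<open>Automata\<close>

definition accepted :: "('s \<times> 'a \<times> 's) set \<Rightarrow> 's set \<Rightarrow> 's \<Rightarrow> (nat \<Rightarrow> 'a) set" where
  "accepted \<delta> Qf q = {\<sigma>. \<exists>r. r 0 = q \<and> (\<forall>n. (r n, \<sigma> n, r (Suc n)) \<in> \<delta>) \<and> (\<exists>\<^sub>\<infinity>n. r n \<in> Qf)}"

lemma buchi_lang_accepted: "buchi_lang Q Qi Qf \<delta> = (\<Union>q\<in>Qi. accepted \<delta> Qf q)"
  by (auto simp: buchi_lang_def accepted_def)

text \<open>A finite state set of any type can be numbered, which permits automata whose states are
  options or sets of triples. Runs stay in \<open>S\<close> because transitions do, so only final
  states in \<open>S\<close> count.\<close>

lemma omega_regularI:
  fixes S :: "'s set" and \<delta> :: "('s \<times> 'a \<times> 's) set"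
  assumes S: "finite S" "q0 \<in> S" "\<delta> \<subseteq> S \<times> UNIV \<times> S"
  shows "omega_regular (accepted \<delta> Qf q0)"
proof -
  obtain f :: "'s \<Rightarrow> nat" where f: "inj_on f S"
    using finite_imp_inj_to_nat_seg[OF S(1)] by blast
  define g where "g = inv_into S f"
  have g: "g (f p) = p" if "p \<in> S" for p
    using f that by (simp add: g_def)
  define \<delta>' where "\<delta>' = (\<lambda>(p, a, q). (f p, a, f q)) ` \<delta>"
  have \<delta>'g: "(g p, a, g q) \<in> \<delta> \<and> g p \<in> S" if "(p, a, q) \<in> \<delta>'" for p a q
    using that S(3) g by (auto simp: \<delta>'_def)
  have "accepted \<delta> Qf q0 = buchi_lang (f ` S) {f q0} (f ` (Qf \<inter> S)) \<delta>'"
  proof (intro equalityI subsetI)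
    fix \<sigma> assume "\<sigma> \<in> accepted \<delta> Qf q0"
    then obtain r where r: "r 0 = q0" "\<And>n. (r n, \<sigma> n, r (Suc n)) \<in> \<delta>" "\<exists>\<^sub>\<infinity>n. r n \<in> Qf"
      by (auto simp: accepted_def)
    have "r n \<in> S" for n using r(2)[of n] S(3) by auto
    then have "\<exists>\<^sub>\<infinity>n. f (r n) \<in> f ` (Qf \<inter> S)"
      by (intro INFM_mono[OF r(3)]) blast
    moreover have "(f (r n), \<sigma> n, f (r (Suc n))) \<in> \<delta>'" for n
      using imageI[OF r(2)[of n], of "\<lambda>(p, a, q). (f p, a, f q)"] by (simp add: \<delta>'_def)
    ultimately show "\<sigma> \<in> buchi_lang (f ` S) {f q0} (f ` (Qf \<inter> S)) \<delta>'"
      unfolding buchi_lang_def using r(1) by (intro CollectI exI[of _ "f \<circ> r"]) auto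
  next
    fix \<sigma> assume "\<sigma> \<in> buchi_lang (f ` S) {f q0} (f ` (Qf \<inter> S)) \<delta>'"
    then obtain r where r: "r 0 = f q0" "\<And>n. (r n, \<sigma> n, r (Suc n)) \<in> \<delta>'" "\<exists>\<^sub>\<infinity>n. r n \<in> f ` (Qf \<inter> S)"
      by (auto simp: buchi_lang_def)
    have "\<exists>\<^sub>\<infinity>n. g (r n) \<in> Qf"
      by (rule INFM_mono[OF r(3)]) (auto simp: g)
    then show "\<sigma> \<in> accepted \<delta> Qf q0"
      unfolding accepted_def using r(1,2) \<delta>'g g S(2) by (intro CollectI exI[of _ "g \<circ> r"]) auto
  qed
  moreover have "\<delta>' \<subseteq> f ` S \<times> UNIV \<times> f ` S"
    using S(3) by (auto simp: \<delta>'_def)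
  ultimately show ?thesis
    unfolding omega_regular_def using S(1,2)
    by (intro exI[of _ "f ` S"] exI[of _ "{f q0}"] exI[of _ "f ` (Qf \<inter> S)"] exI[of _ \<delta>']) auto
qed

text \<open>A fresh start state \<open>None\<close> reads the first letter and is never entered
  again. Iteration gives cylinders and arbitrary finite prefixes.\<close>

lemma omega_regular_shift:
  assumes "omega_regular M"
  shows "omega_regular {\<sigma>. \<sigma> 0 \<in> B \<and> (\<lambda>n. \<sigma> (Suc n)) \<in> M}"
proof -
  obtain Q Qi Qf \<delta> where A: "finite Q" "Qi \<subseteq> Q" "Qf \<subseteq> Q" "\<delta> \<subseteq> Q \<times> UNIV \<times> Q"
    "M = buchi_lang Q Qi Qf \<delta>" using assms unfolding omega_regular_def by blast
  define \<delta>' where "\<delta>' = {(None, a, Some q) |a q. a \<in> B \<and> q \<in> Qi} \<union> {(Some p, a, Some q) |p a q. (p, a, q) \<in> \<delta>}"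
  have "{\<sigma>. \<sigma> 0 \<in> B \<and> (\<lambda>n. \<sigma> (Suc n)) \<in> M} = accepted \<delta>' (Some ` Qf) None"
  proof (intro equalityI subsetI)
    fix \<sigma> assume "\<sigma> \<in> {\<sigma>. \<sigma> 0 \<in> B \<and> (\<lambda>n. \<sigma> (Suc n)) \<in> M}"
    then obtain r where r: "\<sigma> 0 \<in> B" "r 0 \<in> Qi" "\<And>n. (r n, \<sigma> (Suc n), r (Suc n)) \<in> \<delta>" "\<exists>\<^sub>\<infinity>n. r n \<in> Qf"
      by (auto simp: A(5) buchi_lang_def)
    define r' where "r' n = (case n of 0 \<Rightarrow> None | Suc m \<Rightarrow> Some (r m))" for n
    have "(r' n, \<sigma> n, r' (Suc n)) \<in> \<delta>'" for n
      using r by (cases n) (auto simp: r'_def \<delta>'_def)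
    moreover have "\<exists>\<^sub>\<infinity>n. r' n \<in> Some ` Qf"
      unfolding INFM_nat
    proof
      fix m
      obtain n where "n > m" "r n \<in> Qf" using r(4) unfolding INFM_nat by blast
      then show "\<exists>n>m. r' n \<in> Some ` Qf" by (intro exI[of _ "Suc n"]) (auto simp: r'_def)
    qed
    ultimately show "\<sigma> \<in> accepted \<delta>' (Some ` Qf) None"
      unfolding accepted_def by (intro CollectI exI[of _ r']) (auto simp: r'_def)
  next
    fix \<sigma> assume "\<sigma> \<in> accepted \<delta>' (Some ` Qf) None"
    then obtain r where r: "r 0 = None" "\<And>n. (r n, \<sigma> n, r (Suc n)) \<in> \<delta>'" "\<exists>\<^sub>\<infinity>n. r n \<in> Some ` Qf"
      by (auto simp: accepted_def)
    have some: "r (Suc n) = Some (the (r (Suc n)))" for n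
      using r(2)[of n] by (auto simp: \<delta>'_def)
    have "\<sigma> 0 \<in> B" "the (r (Suc 0)) \<in> Qi"
      using r(1) r(2)[of 0] by (auto simp: \<delta>'_def)
    moreover have "(the (r (Suc n)), \<sigma> (Suc n), the (r (Suc (Suc n)))) \<in> \<delta>" for n
      using r(2)[of "Suc n"] some[of n] by (auto simp: \<delta>'_def)
    moreover have "\<exists>\<^sub>\<infinity>n. the (r (Suc n)) \<in> Qf"
      unfolding INFM_nat
    proof
      fix m
      obtain n where "n > Suc m" "r n \<in> Some ` Qf" using r(3) unfolding INFM_nat by blast
      then show "\<exists>n>m. the (r (Suc n)) \<in> Qf" by (intro exI[of _ "n - 1"]) auto
    qed
    ultimately show "\<sigma> \<in> {\<sigma>. \<sigma> 0 \<in> B \<and> (\<lambda>n. \<sigma> (Suc n)) \<in> M}"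
      unfolding A(5) buchi_lang_def by (auto intro!: exI[of _ "\<lambda>n. the (r (Suc n))"])
  qed
  moreover have "omega_regular (accepted \<delta>' (Some ` Qf) None)"
    by (rule omega_regularI[of "insert None (Some ` Q)"]) (use A in \<open>auto simp: \<delta>'_def\<close>)
  ultimately show ?thesis by simp
qed

lemma omega_regular_UNIV: "omega_regular (UNIV :: (nat \<Rightarrow> 'a) set)"
proof -
  have "accepted UNIV UNIV () = (UNIV :: (nat \<Rightarrow> 'a) set)" by (auto simp: accepted_def)
  then show ?thesis
    using omega_regularI[of UNIV "()" "UNIV :: (unit \<times> 'a \<times> unit) set" UNIV] by simp
qed

lemma omega_regular_cyl: "omega_regular (cyl m a)"
proof (induction m)
  case 0
  then show ?case using omega_regular_shift[OF omega_regular_UNIV, of "{a}"] by (simp add: cyl_def)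
next
  case (Suc m)
  then show ?case using omega_regular_shift[of "cyl m a" UNIV] by (simp add: cyl_def)
qed

definition prepend :: "'a list \<Rightarrow> (nat \<Rightarrow> 'a) set \<Rightarrow> (nat \<Rightarrow> 'a) set" where
  "prepend u M = {\<sigma>. (\<forall>i<length u. \<sigma> i = u ! i) \<and> (\<lambda>n. \<sigma> (length u + n)) \<in> M}"

lemma omega_regular_prepend: "omega_regular M \<Longrightarrow> omega_regular (prepend u M)"
proof (induction u)
  case Nil
  then show ?case by (simp add: prepend_def)
next
  case (Cons a u)
  have "prepend (a # u) M = {\<sigma>. \<sigma> 0 \<in> {a} \<and> (\<lambda>n. \<sigma> (Suc n)) \<in> prepend u M}"
    by (auto simp: prepend_def nth_Cons less_Suc_eq_0_disj split: nat.splits)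
  then show ?case using omega_regular_shift[OF Cons.IH[OF Cons.prems], of "{a}"] by simp
qed

lemma countable_omega_regular: "countable {L :: (nat \<Rightarrow> 'a::{finite,countable}) set. omega_regular L}"
proof (rule countable_subset)
  let ?F = "\<lambda>(Qi, Qf, \<delta>). buchi_lang {} Qi Qf \<delta> :: (nat \<Rightarrow> 'a) set"
  \<comment> \<open>As the alphabet is finite, so is the transition relation: a language is given by
    three finite sets over countable types.\<close>
  let ?S = "{Qi. finite Qi} \<times> {Qf. finite Qf} \<times> {\<delta> :: (nat \<times> 'a \<times> nat) set. finite \<delta>}"
  show "{L. omega_regular L} \<subseteq> ?F ` ?S"
  proof
    fix L :: "(nat \<Rightarrow> 'a) set" assume "L \<in> {L. omega_regular L}"
    then obtain Q Qi Qf \<delta> where A: "finite Q" "Qi \<subseteq> Q" "Qf \<subseteq> Q" "\<delta> \<subseteq> Q \<times> UNIV \<times> Q"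
      "L = buchi_lang Q Qi Qf \<delta>" unfolding omega_regular_def by blast
    then have "finite Qi" "finite Qf" "finite \<delta>"
      by (auto intro: finite_subset)
    moreover have "L = ?F (Qi, Qf, \<delta>)" using A(5) by (simp add: buchi_lang_def)
    ultimately show "L \<in> ?F ` ?S" by blast
  qed
  show "countable (?F ` ?S)"
    by (intro countable_image countable_SIGMA countable_Collect_finite)
qed

section \<open>Run segments and transition profiles\<close>

definition segment :: "('s \<times> 'a \<times> 's) set \<Rightarrow> 's set \<Rightarrow> (nat \<Rightarrow> 'a) \<Rightarrow> nat \<Rightarrow> nat \<Rightarrow> 's \<Rightarrow> bool \<Rightarrow> 's \<Rightarrow> bool" where
  "segment \<delta> Qf \<sigma> i j p b q \<longleftrightarrow> (\<exists>r. r i = p \<and> r j = q \<and> (\<forall>n. i \<le> n \<and> n < j \<longrightarrow> (r n, \<sigma> n, r (Suc n)) \<in> \<delta>) \<and>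
      (b \<longrightarrow> (\<exists>n. i < n \<and> n \<le> j \<and> r n \<in> Qf)))"

lemma strict_mono_interval:
  fixes h :: "nat \<Rightarrow> nat"
  assumes "strict_mono h" "h 0 \<le> n"
  obtains k where "h k \<le> n" "n < h (Suc k)"
proof -
  have "finite {k. h k \<le> n}"
  proof (rule finite_subset)
    show "{k. h k \<le> n} \<subseteq> {..n}"
    proof
      fix k assume "k \<in> {k. h k \<le> n}"
      then show "k \<in> {..n}" using strict_mono_imp_increasing[OF assms(1), of k] by simp
    qed
  qed simp
  moreover have "0 \<in> {k. h k \<le> n}" using assms(2) by simp
  ultimately have "Max {k. h k \<le> n} \<in> {k. h k \<le> n}" "Suc (Max {k. h k \<le> n}) \<notin> {k. h k \<le> n}"
    using Max_in Max_ge Suc_n_not_le_n by (metis empty_iff)+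
  then show thesis using that[of "Max {k. h k \<le> n}"] by simp
qed

lemma strict_mono_interval_unique:
  fixes h :: "nat \<Rightarrow> nat"
  assumes "strict_mono h" "h k \<le> n" "n < h (Suc k)" "h l \<le> n" "n < h (Suc l)"
  shows "k = l"
proof -
  have "h (Suc i) \<le> h j" if "i < j" for i j
    using that assms(1) by (simp add: strict_mono_less_eq)
  then show ?thesis
    using assms(2-5) by (metis leD le_less_trans linorder_neqE_nat order_trans)
qed

text \<open>The flag of a segment counts visits after its start up to and including its end, so
  consecutive segments share no visit. Hence infinitely many true flags yield infinitely many visits
  of the glued run.\<close>

lemma segments_accepted:
  assumes h: "strict_mono h" "h 0 = 0"
    and seg: "\<And>k. segment \<delta> Qf \<sigma> (h k) (h (Suc k)) (p k) (b k) (p (Suc k))"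
    and inf: "\<exists>\<^sub>\<infinity>k. b k"
  shows "\<sigma> \<in> accepted \<delta> Qf (p 0)"
proof -
  obtain rr where rr: "\<And>k. rr k (h k) = p k" "\<And>k. rr k (h (Suc k)) = p (Suc k)"
    "\<And>k n. h k \<le> n \<Longrightarrow> n < h (Suc k) \<Longrightarrow> (rr k n, \<sigma> n, rr k (Suc n)) \<in> \<delta>"
    "\<And>k. b k \<Longrightarrow> \<exists>n. h k < n \<and> n \<le> h (Suc k) \<and> rr k n \<in> Qf"
    using seg unfolding segment_def by metis
  \<comment> \<open>At a cut point the later local run is read; the earlier one has the same state
    there.\<close>
  define r where "r n = rr (THE k. h k \<le> n \<and> n < h (Suc k)) n" for n
  have less: "h k < h (Suc k)" for k using h(1) by (simp add: strict_mono_def)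
  have r0: "r n = rr k n" if "h k \<le> n" "n < h (Suc k)" for k n
  proof -
    have "(THE k. h k \<le> n \<and> n < h (Suc k)) = k"
      using that strict_mono_interval_unique[OF h(1)] by (intro the_equality) auto
    then show ?thesis by (simp add: r_def)
  qed
  have r: "r n = rr k n" if "h k \<le> n" "n \<le> h (Suc k)" for k n
  proof (cases "n = h (Suc k)")
    case True
    then show ?thesis using r0[of "Suc k" n] rr(1)[of "Suc k"] rr(2)[of k] less[of "Suc k"] by simp
  qed (use that r0 in auto)
  have "(r n, \<sigma> n, r (Suc n)) \<in> \<delta>" for n
  proof -
    obtain k where k: "h k \<le> n" "n < h (Suc k)"
      using strict_mono_interval[OF h(1)] h(2) by (metis le0)
    then show ?thesis using rr(3)[OF k] r[of k n] r[of k "Suc n"] by simp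
  qed
  moreover have "\<exists>\<^sub>\<infinity>n. r n \<in> Qf"
    unfolding INFM_nat
  proof
    fix m
    obtain k where k: "k > m" "b k" using inf unfolding INFM_nat by blast
    then obtain n where n: "h k < n" "n \<le> h (Suc k)" "rr k n \<in> Qf" using rr(4) by blast
    moreover have "k \<le> h k" using strict_mono_imp_increasing[OF h(1)] by blast
    ultimately show "\<exists>n>m. r n \<in> Qf" using k r[of k n] by (intro exI[of _ n]) auto
  qed
  moreover have "r 0 = p 0" using r0[of 0 0] rr(1)[of 0] h(2) less[of 0] by simp
  ultimately show ?thesis unfolding accepted_def by blast
qed

lemma segment_cong:
  assumes "\<And>n. i \<le> n \<Longrightarrow> n < j \<Longrightarrow> \<sigma> n = \<tau> n"
  shows "segment \<delta> Qf \<sigma> i j p b q \<longleftrightarrow> segment \<delta> Qf \<tau> i j p b q"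
proof -
  have "(\<forall>n. i \<le> n \<and> n < j \<longrightarrow> (r n, \<sigma> n, r (Suc n)) \<in> \<delta>) \<longleftrightarrow>
      (\<forall>n. i \<le> n \<and> n < j \<longrightarrow> (r n, \<tau> n, r (Suc n)) \<in> \<delta>)" for r
    using assms by auto
  then show ?thesis unfolding segment_def by simp
qed

text \<open>Profiles are the finite invariants of word pieces from Buchi's complementation proof,
  and this is the action of one more letter. The flag may always be lowered, as in
  \<open>segment\<close>, where only a true flag makes a claim.\<close>

definition profile_step :: "('s \<times> 'a \<times> 's) set \<Rightarrow> 's set \<Rightarrow> ('s \<times> bool \<times> 's) set \<Rightarrow> 'a \<Rightarrow> ('s \<times> bool \<times> 's) set" where
  "profile_step \<delta> Qf P a = {(p, b, q). \<exists>q' b'. (p, b', q') \<in> P \<and> (q', a, q) \<in> \<delta> \<and> (b \<longrightarrow> b' \<or> q \<in> Qf)}"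

text \<open>The flag is false because an empty piece visits no state after its start, even if the
  start is final.\<close>

definition profile_id :: "'s set \<Rightarrow> ('s \<times> bool \<times> 's) set" where
  "profile_id Q = {(p, False, p) |p. p \<in> Q}"

primrec profile :: "'s set \<Rightarrow> ('s \<times> 'a \<times> 's) set \<Rightarrow> 's set \<Rightarrow> (nat \<Rightarrow> 'a) \<Rightarrow> nat \<Rightarrow> nat \<Rightarrow> ('s \<times> bool \<times> 's) set" where
  "profile Q \<delta> Qf \<sigma> i 0 = profile_id Q"
| "profile Q \<delta> Qf \<sigma> i (Suc l) = profile_step \<delta> Qf (profile Q \<delta> Qf \<sigma> i l) (\<sigma> (i + l))"

lemma segment_Suc:
  assumes "i \<le> j"
  shows "segment \<delta> Qf \<sigma> i (Suc j) p b q \<longleftrightarrow>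
    (\<exists>q' b'. segment \<delta> Qf \<sigma> i j p b' q' \<and> (q', \<sigma> j, q) \<in> \<delta> \<and> (b \<longrightarrow> b' \<or> q \<in> Qf))"
proof
  assume "segment \<delta> Qf \<sigma> i (Suc j) p b q"
  then obtain r where r: "r i = p" "r (Suc j) = q" "\<And>n. i \<le> n \<Longrightarrow> n < Suc j \<Longrightarrow> (r n, \<sigma> n, r (Suc n)) \<in> \<delta>"
    "b \<Longrightarrow> \<exists>n. i < n \<and> n \<le> Suc j \<and> r n \<in> Qf" unfolding segment_def by metis
  have "segment \<delta> Qf \<sigma> i j p (\<exists>n. i < n \<and> n \<le> j \<and> r n \<in> Qf) (r j)"
    unfolding segment_def using r(1,3) by (intro exI[of _ r]) auto
  moreover have "(r j, \<sigma> j, q) \<in> \<delta>" using r(2) r(3)[of j] assms by simp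
  moreover have "b \<longrightarrow> (\<exists>n. i < n \<and> n \<le> j \<and> r n \<in> Qf) \<or> q \<in> Qf"
    using r(2,4) by (auto simp: le_Suc_eq)
  ultimately show "\<exists>q' b'. segment \<delta> Qf \<sigma> i j p b' q' \<and> (q', \<sigma> j, q) \<in> \<delta> \<and> (b \<longrightarrow> b' \<or> q \<in> Qf)"
    by blast
next
  assume "\<exists>q' b'. segment \<delta> Qf \<sigma> i j p b' q' \<and> (q', \<sigma> j, q) \<in> \<delta> \<and> (b \<longrightarrow> b' \<or> q \<in> Qf)"
  then obtain q' b' r where r: "r i = p" "r j = q'" "\<And>n. i \<le> n \<Longrightarrow> n < j \<Longrightarrow> (r n, \<sigma> n, r (Suc n)) \<in> \<delta>"
    "b' \<Longrightarrow> \<exists>n. i < n \<and> n \<le> j \<and> r n \<in> Qf" "(q', \<sigma> j, q) \<in> \<delta>" "b \<longrightarrow> b' \<or> q \<in> Qf"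
    unfolding segment_def by metis
  define r' where "r' = r(Suc j := q)"
  have "(r' n, \<sigma> n, r' (Suc n)) \<in> \<delta>" if "i \<le> n" "n < Suc j" for n
    using that r(2,3,5) by (cases "n = j") (auto simp: r'_def)
  moreover have "\<exists>n. i < n \<and> n \<le> Suc j \<and> r' n \<in> Qf" if b
  proof (cases "q \<in> Qf")
    case True
    then show ?thesis using assms by (intro exI[of _ "Suc j"]) (auto simp: r'_def)
  next
    case False
    then obtain n where "i < n" "n \<le> j" "r n \<in> Qf" using r(4,6) \<open>b\<close> by blast
    then show ?thesis by (intro exI[of _ n]) (auto simp: r'_def)
  qed
  ultimately show "segment \<delta> Qf \<sigma> i (Suc j) p b q"
    unfolding segment_def using r(1) assms by (intro exI[of _ r']) (auto simp: r'_def)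
qed

lemma profile_segment:
  assumes "\<delta> \<subseteq> Q \<times> UNIV \<times> Q"
  shows "(p, b, q) \<in> profile Q \<delta> Qf \<sigma> i l \<longleftrightarrow> p \<in> Q \<and> segment \<delta> Qf \<sigma> i (i + l) p b q"
proof (induction l arbitrary: b q)
  case 0
  show ?case by (auto simp: profile_id_def segment_def)
next
  case (Suc l)
  show ?case
    using Suc by (auto simp: profile_step_def segment_Suc)
qed

lemma profile_subset:
  assumes "\<delta> \<subseteq> Q \<times> UNIV \<times> Q"
  shows "profile Q \<delta> Qf \<sigma> i l \<subseteq> Q \<times> UNIV \<times> Q"
  using assms by (induction l) (auto simp: profile_id_def profile_step_def)

lemma profile_shift: "profile Q \<delta> Qf (\<lambda>n. \<sigma> (k + n)) i l = profile Q \<delta> Qf \<sigma> (k + i) l"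
  by (induction l) (auto simp: add.assoc)

text \<open>The flag of a state marks the beginning of a block.\<close>

definition block_trans :: "'s set \<Rightarrow> ('s \<times> 'a \<times> 's) set \<Rightarrow> 's set \<Rightarrow> ('s \<times> bool \<times> 's) set \<Rightarrow>
    ((('s \<times> bool \<times> 's) set \<times> bool) \<times> 'a \<times> (('s \<times> bool \<times> 's) set \<times> bool)) set" where
  "block_trans Q \<delta> Qf e =
     {((P, f), a, (profile_step \<delta> Qf P a, False)) |P f a. P \<subseteq> Q \<times> UNIV \<times> Q} \<union>
     {((P, f), a, (profile_id Q, True)) |P f a. P \<subseteq> Q \<times> UNIV \<times> Q \<and> profile_step \<delta> Qf P a = e}"

lemma block_trans_step:
  "P \<subseteq> Q \<times> UNIV \<times> Q \<Longrightarrow> ((P, f), a, (profile_step \<delta> Qf P a, False)) \<in> block_trans Q \<delta> Qf e"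
  by (simp add: block_trans_def)

lemma block_trans_restart:
  "P \<subseteq> Q \<times> UNIV \<times> Q \<Longrightarrow> profile_step \<delta> Qf P a = e \<Longrightarrow>
    ((P, f), a, (profile_id Q, True)) \<in> block_trans Q \<delta> Qf e"
  by (simp add: block_trans_def)

definition blocks :: "'s set \<Rightarrow> ('s \<times> 'a \<times> 's) set \<Rightarrow> 's set \<Rightarrow> ('s \<times> bool \<times> 's) set \<Rightarrow> (nat \<Rightarrow> 'a) set" where
  "blocks Q \<delta> Qf e = {\<tau>. \<exists>g. strict_mono g \<and> g 0 = 0 \<and> (\<forall>k. profile Q \<delta> Qf \<tau> (g k) (g (Suc k) - g k) = e)}"

text \<open>The automaton tracks the profile of the current block and guesses where the block ends,
  which is permitted only when the profile is \<open>e\<close>. Flagged states are the block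
  boundaries, so acceptance means that there are infinitely many blocks.\<close>

lemma accepted_block_trans:
  assumes \<delta>: "\<delta> \<subseteq> Q \<times> UNIV \<times> Q"
  shows "accepted (block_trans Q \<delta> Qf e) {s. snd s} (profile_id Q, True) = blocks Q \<delta> Qf e"
proof (intro equalityI subsetI)
  let ?pf = "profile Q \<delta> Qf"
  fix \<tau> assume "\<tau> \<in> accepted (block_trans Q \<delta> Qf e) {s. snd s} (profile_id Q, True)"
  then obtain r where r: "r 0 = (profile_id Q, True)"
    "\<And>n. (r n, \<tau> n, r (Suc n)) \<in> block_trans Q \<delta> Qf e" "\<exists>\<^sub>\<infinity>n. snd (r n)"
    by (auto simp: accepted_def)
  define S where "S = {n. snd (r n)}"
  define g where "g = enumerate S"
  have inf: "infinite S" using r(3) by (simp add: S_def INFM_iff_infinite)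
  have "strict_mono g" unfolding g_def using inf by (rule strict_mono_enumerate)
  have "0 \<in> S" using r(1) by (simp add: S_def)
  then have "g 0 = 0" unfolding g_def by (simp add: enumerate_0 Least_eq_0)
  have gS: "snd (r (g k))" for k
    using enumerate_in_set[OF inf, of k] by (simp add: g_def S_def)
  have start: "r n = (profile_id Q, True)" if "snd (r n)" for n
    using that r(1) r(2)[of "n - 1"] by (cases n) (auto simp: block_trans_def)
  have between: "\<not> snd (r n)" if "g k < n" "n < g (Suc k)" for k n
  proof
    assume "snd (r n)"
    then obtain l where "g l = n" using enumerate_Ex[OF inf, of n] by (auto simp: g_def S_def)
    then show False using that \<open>strict_mono g\<close>
      by (metis less_Suc_eq_le linorder_not_less strict_mono_less)
  qed
  have inner: "fst (r (g k + l)) = ?pf \<tau> (g k) l" if "g k + l < g (Suc k)" for k l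
    using that
  proof (induction l)
    case 0
    then show ?case using start[OF gS] by simp
  next
    case (Suc l)
    then have "\<not> snd (r (Suc (g k + l)))" using between[of k "Suc (g k + l)"] by simp
    then have "fst (r (Suc (g k + l))) = profile_step \<delta> Qf (fst (r (g k + l))) (\<tau> (g k + l))"
      using r(2)[of "g k + l"] by (auto simp: block_trans_def)
    then show ?case using Suc by simp
  qed
  have "?pf \<tau> (g k) (g (Suc k) - g k) = e" for k
  proof -
    have "g k < g (Suc k)" using \<open>strict_mono g\<close> by (simp add: strict_mono_def)
    then obtain l where l: "g (Suc k) = Suc (g k + l)" using less_imp_Suc_add by blast
    then have "profile_step \<delta> Qf (fst (r (g k + l))) (\<tau> (g k + l)) = e"
      using r(2)[of "g k + l"] gS[of "Suc k"] by (auto simp: block_trans_def)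
    then show ?thesis using inner[of k l] l by simp
  qed
  then show "\<tau> \<in> blocks Q \<delta> Qf e"
    using \<open>strict_mono g\<close> \<open>g 0 = 0\<close> unfolding blocks_def by blast
next
  let ?pf = "profile Q \<delta> Qf"
  fix \<tau> assume "\<tau> \<in> blocks Q \<delta> Qf e"
  then obtain g where g: "strict_mono g" "g 0 = 0" "\<And>k. ?pf \<tau> (g k) (g (Suc k) - g k) = e"
    unfolding blocks_def by blast
  define K where "K n = (THE k. g k \<le> n \<and> n < g (Suc k))" for n
  have K: "K n = k" if "g k \<le> n" "n < g (Suc k)" for k n
    unfolding K_def using that strict_mono_interval_unique[OF g(1)] by (intro the_equality) auto
  define r where "r n = (?pf \<tau> (g (K n)) (n - g (K n)), n = g (K n))" for n
  have less: "g k < g (Suc k)" for k using g(1) by (simp add: strict_mono_def)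
  have rg: "r (g k) = (profile_id Q, True)" for k
    using K[of k "g k"] less[of k] by (simp add: r_def)
  have "(r n, \<tau> n, r (Suc n)) \<in> block_trans Q \<delta> Qf e" for n
  proof -
    obtain k where k: "g k \<le> n" "n < g (Suc k)"
      using strict_mono_interval[OF g(1)] g(2) by (metis le0)
    have rn: "r n = (?pf \<tau> (g k) (n - g k), n = g k)"
      using K[OF k] by (simp add: r_def)
    have step: "?pf \<tau> (g k) (Suc n - g k) = profile_step \<delta> Qf (?pf \<tau> (g k) (n - g k)) (\<tau> n)"
      using k(1) by (simp add: Suc_diff_le)
    show ?thesis
    proof (cases "Suc n = g (Suc k)")
      case True
      then have "r (Suc n) = (profile_id Q, True)" using rg[of "Suc k"] by simp
      moreover have "profile_step \<delta> Qf (?pf \<tau> (g k) (n - g k)) (\<tau> n) = e"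
        using g(3)[of k] True step by simp
      ultimately show ?thesis
        using block_trans_restart[OF profile_subset[OF \<delta>]] by (simp add: rn)
    next
      case False
      then have "K (Suc n) = k" using k by (intro K) auto
      then have "r (Suc n) = (profile_step \<delta> Qf (?pf \<tau> (g k) (n - g k)) (\<tau> n), False)"
        using k step by (auto simp: r_def)
      then show ?thesis
        using block_trans_step[OF profile_subset[OF \<delta>]] by (simp add: rn)
    qed
  qed
  moreover have "\<exists>\<^sub>\<infinity>n. r n \<in> {s. snd s}"
    unfolding INFM_nat_le
  proof
    fix m
    have "m \<le> g m" using strict_mono_imp_increasing[OF g(1)] by blast
    then show "\<exists>n\<ge>m. r n \<in> {s. snd s}" using rg[of m] by (intro exI[of _ "g m"]) auto
  qed
  moreover have "r 0 = (profile_id Q, True)" using rg[of 0] g(2) by simp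
  ultimately show "\<tau> \<in> accepted (block_trans Q \<delta> Qf e) {s. snd s} (profile_id Q, True)"
    unfolding accepted_def by blast
qed

lemma omega_regular_blocks:
  assumes "finite Q" "\<delta> \<subseteq> Q \<times> UNIV \<times> Q"
  shows "omega_regular (blocks Q \<delta> Qf e)"
proof -
  have "omega_regular (accepted (block_trans Q \<delta> Qf e) {s. snd s} (profile_id Q, True))"
  proof (rule omega_regularI)
    show "finite (Pow (Q \<times> (UNIV :: bool set) \<times> Q) \<times> (UNIV :: bool set))"
      using assms(1) by simp
    show "(profile_id Q, True) \<in> Pow (Q \<times> UNIV \<times> Q) \<times> UNIV"
      by (auto simp: profile_id_def)
    have "profile_step \<delta> Qf P a \<subseteq> Q \<times> UNIV \<times> Q" if "P \<subseteq> Q \<times> UNIV \<times> Q" for P a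
      using that assms(2) by (auto simp: profile_step_def)
    moreover have "profile_id Q \<subseteq> Q \<times> UNIV \<times> Q" by (auto simp: profile_id_def)
    ultimately show "block_trans Q \<delta> Qf e \<subseteq> (Pow (Q \<times> UNIV \<times> Q) \<times> UNIV) \<times> UNIV \<times> Pow (Q \<times> UNIV \<times> Q) \<times> UNIV"
      unfolding block_trans_def by blast
  qed
  then show ?thesis using accepted_block_trans[OF assms(2)] by simp
qed

text \<open>By Ramsey's theorem a word is a finite prefix followed by blocks with the same profile.
  Any two words with such a common decomposition are accepted or rejected together.\<close>

lemma omega_regular_Compl_cover:
  assumes "omega_regular L" "\<sigma> \<notin> L"
  obtains M where "omega_regular M" "\<sigma> \<in> M" "M \<inter> L = {}"
proof -
  obtain Q Qi Qf \<delta> where A: "finite Q" "Qi \<subseteq> Q" "Qf \<subseteq> Q" "\<delta> \<subseteq> Q \<times> UNIV \<times> Q"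
    "L = buchi_lang Q Qi Qf \<delta>" using assms unfolding omega_regular_def by blast
  let ?pf = "profile Q \<delta> Qf"
  have "finite (Pow (Q \<times> (UNIV :: bool set) \<times> Q))" using A(1) by simp
  from finite_imp_inj_to_nat_seg[OF this] obtain c s where c: "c ` Pow (Q \<times> (UNIV :: bool set) \<times> Q) = {i::nat. i < s}"
    "inj_on c (Pow (Q \<times> (UNIV :: bool set) \<times> Q))"
    by blast
  have pfP: "?pf \<tau> i l \<in> Pow (Q \<times> UNIV \<times> Q)" for \<tau> i l
    using profile_subset[OF A(4)] by blast
  \<comment> \<open>A pair of positions is coloured by the number of the profile of the piece
    between them; there are finitely many profiles.\<close>
  define f where "f X = c (?pf \<sigma> (Min X) (Max X - Min X))" for X
  have "f X < s" for X
    using c(1) pfP by (auto simp: f_def)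
  then have "\<exists>Y t. Y \<subseteq> UNIV \<and> infinite Y \<and> t < s \<and> (\<forall>x\<in>Y. \<forall>y\<in>Y. x \<noteq> y \<longrightarrow> f {x, y} = t)"
    by (intro Ramsey2) auto
  then obtain Y t where Y: "infinite Y" "\<forall>x\<in>Y. \<forall>y\<in>Y. x \<noteq> y \<longrightarrow> f {x, y} = t"
    by blast
  \<comment> \<open>Skipping the least element of \<open>Y\<close> makes \<open>h 0\<close>
    positive, so that 0 can be put in front of the cut points and they still increase
    strictly.\<close>
  define h where "h k = enumerate Y (Suc k)" for k
  have h: "strict_mono h" "h 0 > 0"
    using Y(1) le_less_trans[OF le0 enumerate_step[OF Y(1), of 0]]
    by (auto simp: h_def strict_mono_def simp del: enumerate_Suc)
  have less: "h k < h (Suc k)" for k using h(1) by (simp add: strict_mono_def)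
  have ft: "c (?pf \<sigma> (h k) (h (Suc k) - h k)) = t" for k
  proof -
    have "h k \<in> Y" "h (Suc k) \<in> Y" using enumerate_in_set[OF Y(1)] by (auto simp: h_def)
    then have "f {h k, h (Suc k)} = t" using Y(2) less[of k] by (metis less_irrefl)
    then show ?thesis using less[of k] by (simp add: f_def min_def max_def)
  qed
  define e where "e = ?pf \<sigma> (h 0) (h (Suc 0) - h 0)"
  have e: "?pf \<sigma> (h k) (h (Suc k) - h k) = e" for k
    using ft[of k] ft[of 0] c(2) pfP unfolding e_def by (metis inj_onD)
  define u where "u = map \<sigma> [0..<h 0]"
  define M where "M = prepend u (blocks Q \<delta> Qf e)"
  show thesis
  proof (rule that)
    show "omega_regular M"
      unfolding M_def by (intro omega_regular_prepend omega_regular_blocks A)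
    have "(\<lambda>n. \<sigma> (h 0 + n)) \<in> blocks Q \<delta> Qf e"
      unfolding blocks_def
    proof (intro CollectI exI[of _ "\<lambda>k. h k - h 0"] conjI allI)
      have ge: "h 0 \<le> h k" for k using h(1) by (simp add: strict_mono_less_eq)
      show "strict_mono (\<lambda>k. h k - h 0)"
        using less ge by (auto simp: strict_mono_Suc_iff intro: diff_less_mono)
      show "?pf (\<lambda>n. \<sigma> (h 0 + n)) (h k - h 0) (h (Suc k) - h 0 - (h k - h 0)) = e" for k
        using e[of k] ge[of k] ge[of "Suc k"] by (simp add: profile_shift)
    qed simp
    then show "\<sigma> \<in> M" by (simp add: M_def prepend_def u_def)
    show "M \<inter> L = {}"
    proof (rule ccontr)
      assume "M \<inter> L \<noteq> {}"
      then obtain \<sigma>' where M: "\<sigma>' \<in> M" and L: "\<sigma>' \<in> L" by blast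
      obtain r where r: "r 0 \<in> Qi" "\<And>n. (r n, \<sigma>' n, r (Suc n)) \<in> \<delta>" "\<exists>\<^sub>\<infinity>n. r n \<in> Qf"
        using L by (auto simp: A(5) buchi_lang_def)
      have u: "\<sigma>' i = \<sigma> i" if "i < h 0" for i
        using M that by (auto simp: M_def prepend_def u_def)
      obtain g0 where g0: "strict_mono g0" "g0 0 = 0"
        "\<And>k. ?pf (\<lambda>n. \<sigma>' (h 0 + n)) (g0 k) (g0 (Suc k) - g0 k) = e"
        using M by (auto simp: M_def prepend_def u_def blocks_def)
      define g where "g k = h 0 + g0 k" for k
      have g: "strict_mono g" "g 0 = h 0" "\<And>k. ?pf \<sigma>' (g k) (g (Suc k) - g k) = e"
        using g0 by (auto simp: g_def strict_mono_def profile_shift)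
      have gless: "g k < g (Suc k)" for k using g(1) by (simp add: strict_mono_def)
      define b where "b k \<longleftrightarrow> (\<exists>n. g k < n \<and> n \<le> g (Suc k) \<and> r n \<in> Qf)" for k
      \<comment> \<open>The accepting run on the other word is cut at its block boundaries. Equal
        profiles allow each piece to be replaced by a piece on \<sigma> with the same end states and
        the same flag.\<close>
      have seg: "segment \<delta> Qf \<sigma> (h k) (h (Suc k)) (r (g k)) (b k) (r (g (Suc k)))" for k
      proof -
        have "segment \<delta> Qf \<sigma>' (g k) (g (Suc k)) (r (g k)) (b k) (r (g (Suc k)))"
          unfolding segment_def b_def using r(2) by (intro exI[of _ r]) auto
        moreover have "r (g k) \<in> Q" using r(2)[of "g k"] A(4) by auto
        ultimately have "(r (g k), b k, r (g (Suc k))) \<in> ?pf \<sigma>' (g k) (g (Suc k) - g k)"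
          using profile_segment[OF A(4)] gless[of k] by (metis le_add_diff_inverse less_imp_le)
        then have "(r (g k), b k, r (g (Suc k))) \<in> ?pf \<sigma> (h k) (h (Suc k) - h k)"
          using e g(3) by simp
        then show ?thesis
          using profile_segment[OF A(4)] less[of k] by (metis le_add_diff_inverse less_imp_le)
      qed
      have seg0: "segment \<delta> Qf \<sigma> 0 (h 0) (r 0) False (r (h 0))"
        unfolding segment_def
      proof (intro exI[of _ r] conjI allI impI)
        show "(r n, \<sigma> n, r (Suc n)) \<in> \<delta>" if "0 \<le> n \<and> n < h 0" for n
          using r(2)[of n] u[of n] that by simp
      qed simp_all
      \<comment> \<open>The common prefix is put in front as an extra segment whose flag claims
        nothing.\<close>
      define h' where "h' k = (case k of 0 \<Rightarrow> 0 | Suc l \<Rightarrow> h l)" for k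
      define p where "p k = (case k of 0 \<Rightarrow> r 0 | Suc l \<Rightarrow> r (g l))" for k
      define b' where "b' k = (case k of 0 \<Rightarrow> False | Suc l \<Rightarrow> b l)" for k
      have "\<sigma> \<in> accepted \<delta> Qf (p 0)"
      proof (rule segments_accepted)
        show "strict_mono h'"
          using h(2) less by (auto simp: strict_mono_Suc_iff h'_def split: nat.split)
        show "h' 0 = 0" by (simp add: h'_def)
        show "segment \<delta> Qf \<sigma> (h' k) (h' (Suc k)) (p k) (b' k) (p (Suc k))" for k
          using seg seg0 g(2) by (cases k) (auto simp: h'_def p_def b'_def)
        show "\<exists>\<^sub>\<infinity>k. b' k"
          unfolding INFM_nat
        proof
          fix m
          obtain n where n: "n > g m" "r n \<in> Qf" using r(3) unfolding INFM_nat by blast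
          have "g 0 \<le> g m" using g(1) by (simp add: strict_mono_less_eq)
          \<comment> \<open>A visit at a boundary belongs to the segment that ends there, so the
            segment responsible for \<open>n\<close> is the one whose interval contains
            \<open>n - 1\<close>.\<close>
          then have "g 0 \<le> n - 1" using n by simp
          then obtain k where k: "g k \<le> n - 1" "n - 1 < g (Suc k)"
            by (rule strict_mono_interval[OF g(1)])
          then have "b k" unfolding b_def using n by (intro exI[of _ n]) auto
          moreover have "g m < g (Suc k)" using n k by simp
          then have "m < Suc k" using g(1) by (simp add: strict_mono_less)
          ultimately show "\<exists>n>m. b' n" by (intro exI[of _ "Suc k"]) (simp add: b'_def)
        qed
      qed
      then have "\<sigma> \<in> L" using r(1) by (auto simp: A(5) buchi_lang_accepted p_def)
      then show False using assms(2) by blast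
    qed
  qed
qed

subsection \<open>The Cantor, automatic and Buchi topologies\<close>

lemma openin_cyl: "openin cantor_top (cyl m a)"
proof -
  have "continuous_map cantor_top (discrete_topology UNIV) (\<lambda>\<sigma>. \<sigma> m)"
    unfolding cantor_top_def by (intro continuous_map_product_projection) simp
  from openin_continuous_map_preimage[OF this, of "{a}"] show ?thesis
    by (simp add: cyl_def cantor_top_def)
qed

lemma topspace_cantor_top [simp]: "topspace cantor_top = UNIV"
  by (simp add: cantor_top_def)

lemma openin_Compl_cyl: "openin cantor_top (- cyl m a)"
proof -
  have "openin cantor_top (\<Union>b\<in>- {a}. cyl m b)"
    by (rule openin_Union) (auto simp: openin_cyl)
  moreover have "- cyl m a = (\<Union>b\<in>- {a}. cyl m b)" by (auto simp: cyl_def)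
  ultimately show ?thesis by simp
qed

lemma closedin_cyl: "closedin cantor_top (cyl m a)"
  using openin_Compl_cyl[of m a] by (simp add: closedin_def Compl_eq_Diff_UNIV)

lemma openin_cantor_top_prefix:
  assumes "openin cantor_top U" "x \<in> U"
  obtains k where "\<And>\<sigma>. (\<forall>i<k. \<sigma> i = x i) \<Longrightarrow> \<sigma> \<in> U"
proof -
  obtain X where X: "x \<in> (\<Pi>\<^sub>E i\<in>UNIV. X i)" "finite {i. X i \<noteq> UNIV}" "(\<Pi>\<^sub>E i\<in>UNIV. X i) \<subseteq> U"
    using product_topology_open_contains_basis[OF assms[unfolded cantor_top_def]] by auto
  obtain k where k: "\<And>i. X i \<noteq> UNIV \<Longrightarrow> i < k"
    using X(2) finite_nat_set_iff_bounded by auto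
  have "\<sigma> \<in> U" if "\<forall>i<k. \<sigma> i = x i" for \<sigma>
  proof -
    have "\<sigma> i \<in> X i" for i
    proof (cases "i < k")
      case True
      then show ?thesis using that X(1) by (auto simp: PiE_iff)
    next
      case False
      then show ?thesis using k[of i] by auto
    qed
    then have "\<sigma> \<in> (\<Pi>\<^sub>E i\<in>UNIV. X i)" by auto
    then show ?thesis using X(3) by blast
  qed
  then show thesis using that by blast
qed

lemma topology_generated_by_eqI:
  assumes "\<S> \<subseteq> \<T>" "\<And>T. T \<in> \<T> \<Longrightarrow> openin (topology_generated_by \<S>) T"
  shows "topology_generated_by \<S> = topology_generated_by \<T>"
proof -
  have "openin (topology_generated_by \<T>) U" if "openin (topology_generated_by \<S>) U" for U
    using generate_topology_on_coarsest[of "openin (topology_generated_by \<T>)" \<S> U] that assms(1)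
    by (auto simp: openin_topology_generated_by_iff topology_generated_by_Basis istopology_generate_topology_on
        intro: generate_topology_on.Basis)
  moreover have "openin (topology_generated_by \<S>) U" if "openin (topology_generated_by \<T>) U" for U
    using generate_topology_on_coarsest[of "openin (topology_generated_by \<S>)" \<T> U] that assms(2)
    by (auto simp: openin_topology_generated_by_iff istopology_generate_topology_on)
  ultimately show ?thesis unfolding topology_eq by blast
qed

lemma cantor_top_generated:
  "cantor_top = topology_generated_by (range (\<lambda>(m, a). cyl m a) \<union> range (\<lambda>(m, a). - cyl m a))"
    (is "_ = topology_generated_by ?D")
proof -
  have base: "openin cantor_top U \<longleftrightarrow> openin (topology_generated_by ?D) U" for U
  proof
    assume U: "openin cantor_top U"
    have "\<exists>T. openin (topology_generated_by ?D) T \<and> x \<in> T \<and> T \<subseteq> U" if xU: "x \<in> U" for x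
    proof -
      obtain k where k: "\<And>\<sigma>. (\<forall>i<k. \<sigma> i = x i) \<Longrightarrow> \<sigma> \<in> U"
        by (rule openin_cantor_top_prefix[OF U xU]) blast
      have "openin (topology_generated_by ?D) (cyl i (x i))" for i
        by (rule topology_generated_by_Basis) auto
      \<comment> \<open>The index set \<open>{..k}\<close> is nonempty even for k = 0, as
        \<open>openin_Inter\<close> requires.\<close>
      then have "openin (topology_generated_by ?D) (\<Inter>i\<in>{..k}. cyl i (x i))"
        by (intro openin_Inter) auto
      moreover have "(\<Inter>i\<in>{..k}. cyl i (x i)) \<subseteq> U"
        using k by (auto simp: cyl_def)
      ultimately show ?thesis by (intro exI[of _ "\<Inter>i\<in>{..k}. cyl i (x i)"]) (auto simp: cyl_def)
    qed
    then show "openin (topology_generated_by ?D) U" by (subst openin_subopen) blast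
  next
    assume "openin (topology_generated_by ?D) U"
    then have "generate_topology_on ?D U" by (simp add: openin_topology_generated_by_iff)
    then show "openin cantor_top U"
    proof (rule generate_topology_on_coarsest[rotated 2])
      show "istopology (openin cantor_top)" by (rule istopology_openin)
      show "openin cantor_top S" if "S \<in> ?D" for S
        using that openin_cyl openin_Compl_cyl by auto
    qed
  qed
  then show ?thesis unfolding topology_eq by blast
qed

text \<open>Each generator concerns a single letter, and \<open>adequate\<close> ties single letters
  to \<open>x\<close>, so the empty supply of covers serves.\<close>

lemma Polish_cantor_top:
  "Polish_space (cantor_top :: (nat \<Rightarrow> 'a::countable) topology) \<and>
   zero_dimensional (cantor_top :: (nat \<Rightarrow> 'a) topology)"
  unfolding cantor_top_generated
proof (rule Polish_words)
  let ?D = "range (\<lambda>(m, a). cyl m a) \<union> range (\<lambda>(m, a :: 'a). - cyl m a)"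
  show "countable ?D" by simp
  show "- D \<in> ?D" if "D \<in> ?D" for D using that by fastforce
  show "cyl m a \<in> ?D" for m a by auto
  fix D assume D: "D \<in> ?D"
  have "x \<in> D" if "adequate ?D {} Y x" "D \<in> Y" for Y x
  proof -
    have Y: "cyl m a \<in> Y \<longleftrightarrow> - cyl m a \<notin> Y" "cyl m a \<in> Y \<longleftrightarrow> x m = a" for m a
      using adequate_cyl[OF that(1)] adequate_Compl[OF that(1), of "cyl m a"] by auto
    from D consider m a where "D = cyl m a" | m a where "D = - cyl m a" by auto
    then show ?thesis
    proof cases
      case 1
      then show ?thesis using Y(2) that(2) by (simp add: cyl_def)
    next
      case 2
      then show ?thesis using Y that(2) by (auto simp: cyl_def)
    qed
  qed
  then show "\<exists>\<K>. countable \<K> \<and> \<K> \<subseteq> Pow ?D \<and> (\<forall>Y x. adequate ?D \<K> Y x \<longrightarrow> D \<in> Y \<longrightarrow> x \<in> D)"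
    by (intro exI[of _ "{}"]) auto
qed

text \<open>A nonempty finite piece of an accepting run is added at each step, so that a subfamily
  containing the language yields an accepting run on the word \<open>x\<close> it determines.\<close>

lemma omega_regular_witness:
  fixes L :: "(nat \<Rightarrow> 'a::{finite,countable}) set"
  assumes L: "omega_regular L" and D: "{L. omega_regular L} \<subseteq> \<D>"
  shows "\<exists>\<K>. countable \<K> \<and> \<K> \<subseteq> Pow \<D> \<and> (\<forall>Y x. adequate \<D> \<K> Y x \<longrightarrow> L \<in> Y \<longrightarrow> x \<in> L)"
proof -
  obtain Q Qi Qf \<delta> where A: "finite Q" "Qi \<subseteq> Q" "Qf \<subseteq> Q" "\<delta> \<subseteq> Q \<times> UNIV \<times> Q"
    "L = buchi_lang Q Qi Qf \<delta>" using L unfolding omega_regular_def by blast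
  \<comment> \<open>\<open>E u q\<close> describes a partial construction: \<open>u\<close> is the
    prefix read so far and \<open>q\<close> the state reached.\<close>
  define E where "E u q = prepend u (accepted \<delta> Qf q)" for u :: "'a list" and q
  \<comment> \<open>The true flag forces a final state into every extension, so infinitely many
    steps give acceptance. The list \<open>w\<close> stands in for a word; the segment reads it only
    below its length.\<close>
  define nxt where "nxt u q w q' \<longleftrightarrow> length u < length w \<and> q' \<in> Q \<and>
      segment \<delta> Qf ((!) w) (length u) (length w) q True q'" for u w :: "'a list" and q q'
  define K where "K u q = {E w q' |w q'. nxt u q w q'}" for u q
  have ED: "E u q \<in> \<D>" if "q \<in> Q" for u q
    using omega_regular_prepend[OF omega_regularI[OF A(1) that A(4)]] D by (auto simp: E_def)
  have EK: "E u q \<subseteq> \<Union>(K u q)" for u q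
  proof
    fix \<sigma> assume "\<sigma> \<in> E u q"
    then obtain r where r: "r 0 = q" "\<And>n. (r n, \<sigma> (length u + n), r (Suc n)) \<in> \<delta>" "\<exists>\<^sub>\<infinity>n. r n \<in> Qf"
      by (auto simp: E_def prepend_def accepted_def)
    obtain n where n: "n > 0" "r n \<in> Qf" using r(3) unfolding INFM_nat by blast
    define w where "w = map \<sigma> [0..<length u + n]"
    have "segment \<delta> Qf ((!) w) (length u) (length w) q True (r n)"
      unfolding segment_def
    proof (intro exI[of _ "\<lambda>m. r (m - length u)"] conjI allI impI)
      fix m assume m: "length u \<le> m \<and> m < length w"
      then show "(r (m - length u), w ! m, r (Suc m - length u)) \<in> \<delta>"
        using r(2)[of "m - length u"] by (simp add: w_def Suc_diff_le)
    next
      show "\<exists>m>length u. m \<le> length w \<and> r (m - length u) \<in> Qf"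
        using n by (intro exI[of _ "length u + n"]) (simp add: w_def)
    qed (use r(1) in \<open>simp_all add: w_def\<close>)
    moreover have "\<sigma> \<in> E w (r n)"
    proof -
      have "(\<lambda>m. \<sigma> (length w + m)) \<in> accepted \<delta> Qf (r n)"
        unfolding accepted_def
      proof (intro CollectI exI[of _ "\<lambda>m. r (n + m)"] conjI allI)
        show "(r (n + m), \<sigma> (length w + m), r (n + Suc m)) \<in> \<delta>" for m
          using r(2)[of "n + m"] by (simp add: w_def add.assoc)
        show "\<exists>\<^sub>\<infinity>m. r (n + m) \<in> Qf"
          unfolding INFM_nat
        proof
          fix m
          obtain j where "j > n + m" "r j \<in> Qf" using r(3) unfolding INFM_nat by blast
          then show "\<exists>j>m. r (n + j) \<in> Qf" by (intro exI[of _ "j - n"]) auto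
        qed
      qed simp
      then show ?thesis by (simp add: E_def prepend_def w_def)
    qed
    moreover have "r n \<in> Q" using n A(3) by blast
    moreover have "length u < length w" using n by (simp add: w_def)
    ultimately have "nxt u q w (r n)" "\<sigma> \<in> E w (r n)"
      by (simp_all add: nxt_def)
    then show "\<sigma> \<in> \<Union>(K u q)" unfolding K_def by blast
  qed
  have KD: "K u q \<subseteq> \<D>" for u q
    using ED by (auto simp: K_def nxt_def)
  define \<K> where "\<K> = range (\<lambda>(u, q). K u q) \<union> {E [] ` Qi}"
  have LE: "L = \<Union>(E [] ` Qi)"
    by (simp add: A(5) buchi_lang_accepted E_def prepend_def)
  show ?thesis
  proof (intro exI[of _ \<K>] conjI allI impI)
    show "countable \<K>" by (simp add: \<K>_def)
    show "\<K> \<subseteq> Pow \<D>" using KD ED A(2) by (auto simp: \<K>_def; blast)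
    fix Y x assume ad: "adequate \<D> \<K> Y x" and LY: "L \<in> Y"
    have "\<exists>G\<in>E [] ` Qi. G \<in> Y"
      by (rule adequate_cover[OF ad LY]) (auto simp: \<K>_def LE)
    then obtain q0 where q0: "q0 \<in> Qi" "E [] q0 \<in> Y" by blast
    have step: "\<exists>w q'. nxt u q w q' \<and> E w q' \<in> Y" if "E u q \<in> Y" for u q
    proof -
      have "K u q \<in> \<K>" by (auto simp: \<K>_def)
      from adequate_cover[OF ad that this EK] show ?thesis by (auto simp: K_def)
    qed
    \<comment> \<open>The pieces of run are chosen through \<open>Y\<close> without looking at
      \<open>x\<close>; that their labels agree with \<open>x\<close> follows because
      \<open>Y\<close> contains the cylinders around the chosen prefix.\<close>
    have pre: "u ! i = x i" if "E u q \<in> Y" "i < length u" for u q i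
    proof -
      have "cyl i (u ! i) \<in> Y"
      proof (rule adequate_subset[OF ad that(1)])
        show "cyl i (u ! i) \<in> \<D>" using omega_regular_cyl[of i "u ! i"] D by auto
        show "E u q \<subseteq> cyl i (u ! i)" using that(2) by (auto simp: E_def prepend_def cyl_def)
      qed
      then show ?thesis using adequate_cyl[OF ad] by metis
    qed
    have "\<exists>f. \<forall>n. (E (fst (f n)) (snd (f n)) \<in> Y \<and> (n = 0 \<longrightarrow> f n = ([], q0))) \<and>
        nxt (fst (f n)) (snd (f n)) (fst (f (Suc n))) (snd (f (Suc n)))"
    proof (rule dependent_nat_choice)
      show "\<exists>y. E (fst y) (snd y) \<in> Y \<and> ((0::nat) = 0 \<longrightarrow> y = ([], q0))"
        using q0(2) by (intro exI[of _ "([], q0)"]) simp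
      fix y and n :: nat assume "E (fst y) (snd y) \<in> Y \<and> (n = 0 \<longrightarrow> y = ([], q0))"
      then obtain w q' where "nxt (fst y) (snd y) w q'" "E w q' \<in> Y" using step by blast
      then show "\<exists>z. (E (fst z) (snd z) \<in> Y \<and> (Suc n = 0 \<longrightarrow> z = ([], q0))) \<and>
          nxt (fst y) (snd y) (fst z) (snd z)"
        by (intro exI[of _ "(w, q')"]) simp
    qed
    then obtain f where f: "\<And>n. E (fst (f n)) (snd (f n)) \<in> Y" "f 0 = ([], q0)"
      "\<And>n. nxt (fst (f n)) (snd (f n)) (fst (f (Suc n))) (snd (f (Suc n)))" by metis
    define h where "h n = length (fst (f n))" for n
    have "x \<in> accepted \<delta> Qf (snd (f 0))"
    proof (rule segments_accepted)
      show "strict_mono h" using f(3) by (simp add: strict_mono_Suc_iff h_def nxt_def)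
      show "h 0 = 0" by (simp add: h_def f(2))
      show "segment \<delta> Qf x (h k) (h (Suc k)) (snd (f k)) True (snd (f (Suc k)))" for k
      proof -
        have "segment \<delta> Qf ((!) (fst (f (Suc k)))) (h k) (h (Suc k)) (snd (f k)) True (snd (f (Suc k)))"
          using f(3)[of k] by (simp add: nxt_def h_def)
        moreover have "fst (f (Suc k)) ! n = x n" if "h k \<le> n" "n < h (Suc k)" for n
          using pre[OF f(1)[of "Suc k"]] that by (simp add: h_def)
        ultimately show ?thesis by (rule segment_cong[THEN iffD1, rotated])
      qed
    qed (simp add: INFM_nat gt_ex)
    then show "x \<in> L" using q0(1) f(2) by (auto simp: A(5) buchi_lang_accepted)
  qed
qed

section \<open>The Buchi and the automatic topology\<close>

lemma countable_with_Compl: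
  fixes P :: "'a set \<Rightarrow> bool"
  assumes c: "countable {L. P L}"
  shows "countable {L. P L \<or> P (- L)}"
proof -
  have "{L. P L \<or> P (- L)} = {L. P L} \<union> uminus ` {L. P L}"
  proof (intro equalityI subsetI)
    fix L assume "L \<in> {L. P L \<or> P (- L)}"
    then show "L \<in> {L. P L} \<union> uminus ` {L. P L}"
      using image_eqI[of L uminus "- L"] by auto
  qed auto
  then show ?thesis using c by simp
qed

text \<open>Passing from \<open>?R\<close> to \<open>?D\<close> gives closure under complement at
  once, and \<open>omega_regular_Compl_cover\<close> shows that no new open sets arise.\<close>

lemma Polish_omega_regular:
  "Polish_space (topology_generated_by {L :: (nat \<Rightarrow> 'a::{finite,countable}) set. omega_regular L}) \<and>
   zero_dimensional (topology_generated_by {L :: (nat \<Rightarrow> 'a) set. omega_regular L})"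
proof -
  let ?R = "{L :: (nat \<Rightarrow> 'a) set. omega_regular L}"
  let ?D = "{L :: (nat \<Rightarrow> 'a) set. omega_regular L \<or> omega_regular (- L)}"
  define co where "co L = {M. omega_regular M \<and> M \<inter> L = {}}" for L :: "(nat \<Rightarrow> 'a) set"
  have co: "- L = \<Union>(co L)" if "omega_regular L" for L
    using omega_regular_Compl_cover[OF that] unfolding co_def by blast
  have "topology_generated_by ?R = topology_generated_by ?D"
  proof (rule topology_generated_by_eqI)
    fix T assume "T \<in> ?D"
    then consider "T \<in> ?R" | "omega_regular (- T)" by blast
    then show "openin (topology_generated_by ?R) T"
    proof cases
      case 1
      then show ?thesis by (rule topology_generated_by_Basis)
    next
      case 2
      then have "T = \<Union>(co (- T))" using co[OF 2] by simp
      moreover have "openin (topology_generated_by ?R) (\<Union>(co (- T)))"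
        by (rule openin_Union) (auto simp: co_def intro: topology_generated_by_Basis)
      ultimately show ?thesis by simp
    qed
  qed auto
  moreover have "Polish_space (topology_generated_by ?D) \<and> zero_dimensional (topology_generated_by ?D)"
  proof (rule Polish_words)
    show "countable ?D" by (rule countable_with_Compl[OF countable_omega_regular])
    show "cyl m a \<in> ?D" for m a using omega_regular_cyl[of m a] by simp
    show "- D \<in> ?D" if "D \<in> ?D" for D using that by auto
    have RD: "?R \<subseteq> ?D" by blast
    fix D assume "D \<in> ?D"
    then consider "omega_regular D" | "omega_regular (- D)" by blast
    then show "\<exists>\<K>. countable \<K> \<and> \<K> \<subseteq> Pow ?D \<and> (\<forall>Y x. adequate ?D \<K> Y x \<longrightarrow> D \<in> Y \<longrightarrow> x \<in> D)"
    proof cases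
      case 1
      then show ?thesis by (rule omega_regular_witness[OF _ RD])
    next
      case 2
      have "\<forall>M\<in>?R. \<exists>\<K>. countable \<K> \<and> \<K> \<subseteq> Pow ?D \<and> (\<forall>Y x. adequate ?D \<K> Y x \<longrightarrow> M \<in> Y \<longrightarrow> x \<in> M)"
        using omega_regular_witness[OF _ RD] by blast
      from bchoice[OF this] obtain KK where "\<forall>M\<in>?R. countable (KK M) \<and> KK M \<subseteq> Pow ?D \<and>
          (\<forall>Y x. adequate ?D (KK M) Y x \<longrightarrow> M \<in> Y \<longrightarrow> x \<in> M)" ..
      note KK = bspec[OF this]
      have coR: "co (- D) \<subseteq> ?R" by (auto simp: co_def)
      have DU: "D = \<Union>(co (- D))" using co[OF 2] by simp
      \<comment> \<open>For a complement \<open>D\<close> in \<open>Y\<close>, the cover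
        \<open>co (- D)\<close> puts some omega-regular subset \<open>M\<close> of \<open>D\<close>
        into \<open>Y\<close>; the covers belonging to \<open>M\<close> then place \<open>x\<close>
        in \<open>M\<close>.\<close>
      show ?thesis
      proof (intro exI[of _ "insert (co (- D)) (\<Union>(KK ` co (- D)))"] conjI allI impI)
        have "countable (co (- D))"
          using coR countable_omega_regular by (rule countable_subset)
        then show "countable (insert (co (- D)) (\<Union>(KK ` co (- D))))"
          using KK coR by (intro countable_insert countable_UN) auto
        show "insert (co (- D)) (\<Union>(KK ` co (- D))) \<subseteq> Pow ?D"
          using KK coR RD by (intro insert_subsetI UN_least) auto
        fix Y x assume ad: "adequate ?D (insert (co (- D)) (\<Union>(KK ` co (- D)))) Y x" and "D \<in> Y"
        then obtain M where M: "M \<in> co (- D)" "M \<in> Y"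
          using adequate_cover[OF ad \<open>D \<in> Y\<close>, of "co (- D)"] DU by blast
        have "adequate ?D (KK M) Y x"
          by (rule adequate_mono[OF ad]) (use M(1) in auto)
        moreover have "M \<in> ?R" using M(1) coR by (rule subsetD[rotated])
        ultimately have "x \<in> M" using KK[of M] M(2) by simp
        then show "x \<in> D" using DU M(1) by blast
      qed
    qed
  qed
  ultimately show ?thesis by simp
qed

lemma prepend_UNIV: "prepend u UNIV = {\<sigma>. \<forall>i<length u. \<sigma> i = u ! i}"
  by (simp add: prepend_def)

lemma closedin_prepend_UNIV: "closedin cantor_top (prepend u UNIV)"
proof -
  have "prepend u UNIV = (\<Inter>i\<in>{..<length u}. cyl i (u ! i))"
    by (auto simp: prepend_UNIV cyl_def)
  moreover have "closedin cantor_top (\<Inter>i\<in>{..<length u}. cyl i (u ! i))"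
  proof (cases "u = []")
    case True
    then show ?thesis using closedin_topspace[of "cantor_top :: (nat \<Rightarrow> 'a) topology"] by simp
  next
    case False
    then show ?thesis using closedin_cyl by (intro closedin_INT) auto
  qed
  ultimately show ?thesis by simp
qed

text \<open>The complement of a closed language is a union of sets \<open>prepend u UNIV\<close>,
  which are themselves closed and omega-regular. Such unions play the part that the Ramsey argument
  plays for general omega-regular languages.\<close>

lemma Polish_closed_omega_regular:
  "Polish_space (topology_generated_by
      {L :: (nat \<Rightarrow> 'a::{finite,countable}) set. omega_regular L \<and> closedin cantor_top L}) \<and>
   zero_dimensional (topology_generated_by {L :: (nat \<Rightarrow> 'a) set. omega_regular L \<and> closedin cantor_top L})"
proof -
  define P where "P L \<longleftrightarrow> omega_regular L \<and> closedin cantor_top L" for L :: "(nat \<Rightarrow> 'a) set"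
  let ?R = "{L. P L}" and ?D = "{L. P L \<or> P (- L)}"
  have P_prepend: "P (prepend u UNIV)" for u
    by (simp add: P_def omega_regular_prepend omega_regular_UNIV closedin_prepend_UNIV)
  have P_cyl: "P (cyl m a)" for m a
    by (simp add: P_def omega_regular_cyl closedin_cyl)
  define co where "co L = {prepend u UNIV |u. prepend u UNIV \<inter> L = {}}" for L :: "(nat \<Rightarrow> 'a) set"
  have co: "- L = \<Union>(co L)" if "P L" for L
  proof
    show "- L \<subseteq> \<Union>(co L)"
    proof
      fix \<sigma> assume \<sigma>: "\<sigma> \<in> - L"
      have "openin cantor_top (- L)"
        using that by (simp add: P_def closedin_def Compl_eq_Diff_UNIV)
      then obtain k where k: "\<And>\<tau>. (\<forall>i<k. \<tau> i = \<sigma> i) \<Longrightarrow> \<tau> \<in> - L"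
        by (rule openin_cantor_top_prefix[OF _ \<sigma>]) blast
      then have "prepend (map \<sigma> [0..<k]) UNIV \<in> co L" "\<sigma> \<in> prepend (map \<sigma> [0..<k]) UNIV"
        unfolding co_def by (fastforce simp: prepend_UNIV)+
      then show "\<sigma> \<in> \<Union>(co L)" by blast
    qed
  qed (auto simp: co_def)
  have "topology_generated_by ?R = topology_generated_by ?D"
  proof (rule topology_generated_by_eqI)
    fix T assume "T \<in> ?D"
    then consider "T \<in> ?R" | "P (- T)" by blast
    then show "openin (topology_generated_by ?R) T"
    proof cases
      case 1
      then show ?thesis by (rule topology_generated_by_Basis)
    next
      case 2
      then have "T = \<Union>(co (- T))" using co[OF 2] by simp
      moreover have "openin (topology_generated_by ?R) (\<Union>(co (- T)))"
        by (rule openin_Union) (auto simp: co_def P_prepend intro: topology_generated_by_Basis)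
      ultimately show ?thesis by simp
    qed
  qed auto
  moreover have "Polish_space (topology_generated_by ?D) \<and> zero_dimensional (topology_generated_by ?D)"
  proof (rule Polish_words)
    show "countable ?D"
      by (rule countable_with_Compl, rule countable_subset[OF _ countable_omega_regular]) (auto simp: P_def)
    show cylD: "cyl m a \<in> ?D" for m a using P_cyl[of m a] by simp
    show complD: "- D \<in> ?D" if "D \<in> ?D" for D using that by auto
    \<comment> \<open>A closed set missing \<open>x\<close> misses all words sharing a long enough
      prefix with \<open>x\<close>. It is then covered near \<open>x\<close> by the empty family and
      cannot be in \<open>Y\<close>.\<close>
    have closed: "x \<in> D" if "P D" "adequate ?D \<K> Y x" "D \<in> Y" for D \<K> Y x
    proof (rule ccontr)
      assume x: "x \<notin> D"
      have "openin cantor_top (- D)"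
        using that by (simp add: P_def closedin_def Compl_eq_Diff_UNIV)
      moreover have "x \<in> - D" using x by simp
      ultimately obtain k where k: "\<And>\<sigma>. (\<forall>i<k. \<sigma> i = x i) \<Longrightarrow> \<sigma> \<in> - D"
        by (rule openin_cantor_top_prefix) blast
      have "\<exists>G\<in>{} \<union> {}. G \<in> Y"
        by (rule adequate_local_cover[OF that(2,3) _ _ _ cylD complD, where k = k]) (use k in auto)
      then show False by simp
    qed
    fix D assume "D \<in> ?D"
    then consider "P D" | "P (- D)" by blast
    then show "\<exists>\<K>. countable \<K> \<and> \<K> \<subseteq> Pow ?D \<and> (\<forall>Y x. adequate ?D \<K> Y x \<longrightarrow> D \<in> Y \<longrightarrow> x \<in> D)"
    proof cases
      case 1
      then show ?thesis using closed by (intro exI[of _ "{}"]) auto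
    next
      case 2
      have DU: "D = \<Union>(co (- D))" using co[OF 2] by simp
      show ?thesis
      proof (intro exI[of _ "{co (- D)}"] conjI allI impI)
        show "{co (- D)} \<subseteq> Pow ?D" using P_prepend by (auto simp: co_def)
        fix Y x assume ad: "adequate ?D {co (- D)} Y x" and "D \<in> Y"
        then obtain M where M: "M \<in> co (- D)" "M \<in> Y"
          using adequate_cover[OF ad \<open>D \<in> Y\<close>, of "co (- D)"] DU by blast
        then have "x \<in> M" using closed[OF _ ad M(2)] P_prepend by (auto simp: co_def)
        then show "x \<in> D" using DU M(1) by blast
      qed simp
    qed
  qed
  ultimately show ?thesis by (simp add: P_def)
qed

theorem theorem1:
  fixes z :: top_kind
  assumes "CARD('a::finite) \<ge> 2"
  shows "Polish_space (tau z :: (nat \<Rightarrow> 'a::{finite,countable}) topology)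
       \<and> zero_dimensional (tau z :: (nat \<Rightarrow> 'a) topology)"
  using Polish_cantor_top Polish_omega_regular Polish_closed_omega_regular Polish_Delta11
  by (cases z) (simp_all add: tau_def)

end
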